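(* For every graph $G$ of tree-width $t\geq 2$, we have $f_1(G) \leq \binom{t+1}{2}$ and $f_2(G)\leq 3\binom{t+1}{3}$.
   Context: All graphs are simple, finite and undirected. An induced forest in $G$ is an acyclic induced subgraph of $G$. For $k\geq 1$, a $k$-strong forest of $G$ is an induced forest in $G$ each of whose connected components has at least $k$ edges. An edge of $G$ is $k$-valid if it is contained in some $k$-strong forest of $G$. The $k$-strong induced arboricity $f_k(G)$ is the smallest number of $k$-strong forests of $G$ that together cover all $k$-valid edges of $G$ (so $f_k(G)=0$ if $G$ has no $k$-valid edges). *)

theory Defs
  imports Complex_Main
begin

record 'a ugraph =
  verts :: "'a set"
  edges :: "'a set set"

definition simple_graph :: "'a ugraph \<Rightarrow> bool" where
  "simple_graph G \<longleftrightarrow> finite (verts G) \<and>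
     (\<forall>e\<in>edges G. \<exists>u\<in>verts G. \<exists>v\<in>verts G. u \<noteq> v \<and> e = {u, v})"

text \<open>Meant to be used with a subset \<open>W\<close> of the vertex set of \<open>G\<close>.\<close>

definition induce :: "'a ugraph \<Rightarrow> 'a set \<Rightarrow> 'a ugraph" where
  "induce G W = \<lparr>verts = W, edges = {e \<in> edges G. e \<subseteq> W}\<rparr>"

definition induced_subgraph :: "'a ugraph \<Rightarrow> 'a ugraph \<Rightarrow> bool" where
  "induced_subgraph H G \<longleftrightarrow> (\<exists>W \<subseteq> verts G. H = induce G W)"

definition adj :: "'a ugraph \<Rightarrow> ('a \<times> 'a) set" where
  "adj G = {(u, v). {u, v} \<in> edges G}"

text \<open>The vertex list of a cycle, in cyclic order and without repeating the starting vertex.\<close>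

definition is_cycle :: "'a ugraph \<Rightarrow> 'a list \<Rightarrow> bool" where
  "is_cycle G p \<longleftrightarrow> 3 \<le> length p \<and> distinct p \<and> set p \<subseteq> verts G \<and>
     (\<forall>i<length p. (p ! i, p ! (Suc i mod length p)) \<in> adj G)"

definition acyclic_graph :: "'a ugraph \<Rightarrow> bool" where
  "acyclic_graph G \<longleftrightarrow> (\<nexists>p. is_cycle G p)"

definition connected_graph :: "'a ugraph \<Rightarrow> bool" where
  "connected_graph G \<longleftrightarrow> verts G \<noteq> {} \<and> (\<forall>u\<in>verts G. \<forall>v\<in>verts G. (u, v) \<in> (adj G)\<^sup>*)"

definition components :: "'a ugraph \<Rightarrow> 'a ugraph set" where
  "components G = (\<lambda>v. induce G {u. (v, u) \<in> (adj G)\<^sup>*}) ` verts G"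

definition is_tree :: "'a ugraph \<Rightarrow> bool" where
  "is_tree T \<longleftrightarrow> simple_graph T \<and> connected_graph T \<and> acyclic_graph T"

definition tree_decomposition :: "'a ugraph \<Rightarrow> 'b ugraph \<Rightarrow> ('b \<Rightarrow> 'a set) \<Rightarrow> bool" where
  "tree_decomposition G T B \<longleftrightarrow> is_tree T \<and>
     (\<Union>x\<in>verts T. B x) = verts G \<and>
     (\<forall>e\<in>edges G. \<exists>x\<in>verts T. e \<subseteq> B x) \<and>
     (\<forall>v\<in>verts G. connected_graph (induce T {x \<in> verts T. v \<in> B x}))"

text \<open>The subtraction truncates only for decompositions whose bags are all empty, so
  the graph without vertices gets tree-width 0 here (and not -1).\<close>

definition decomposition_width :: "'b ugraph \<Rightarrow> ('b \<Rightarrow> 'a set) \<Rightarrow> nat" where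
  "decomposition_width T B = Max ((\<lambda>x. card (B x)) ` verts T) - 1"

text \<open>Trees are finite, so it is no restriction to take their nodes from \<open>nat\<close>.\<close>

definition tree_width :: "'a ugraph \<Rightarrow> nat" where
  "tree_width G = (LEAST w. \<exists>(T :: nat ugraph) B.
     tree_decomposition G T B \<and> decomposition_width T B = w)"

definition strong_forest :: "nat \<Rightarrow> 'a ugraph \<Rightarrow> 'a ugraph \<Rightarrow> bool" where
  "strong_forest k G F \<longleftrightarrow> induced_subgraph F G \<and> acyclic_graph F \<and>
     (\<forall>C\<in>components F. k \<le> card (edges C))"

definition valid_edge :: "nat \<Rightarrow> 'a ugraph \<Rightarrow> 'a set \<Rightarrow> bool" where
  "valid_edge k G e \<longleftrightarrow> e \<in> edges G \<and> (\<exists>F. strong_forest k G F \<and> e \<in> edges F)"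

definition covers_valid_edges :: "nat \<Rightarrow> 'a ugraph \<Rightarrow> 'a ugraph set \<Rightarrow> bool" where
  "covers_valid_edges k G \<F> \<longleftrightarrow> finite \<F> \<and> (\<forall>F\<in>\<F>. strong_forest k G F) \<and>
     (\<forall>e. valid_edge k G e \<longrightarrow> (\<exists>F\<in>\<F>. e \<in> edges F))"

definition strong_induced_arboricity :: "nat \<Rightarrow> 'a ugraph \<Rightarrow> nat" where
  "strong_induced_arboricity k G = (LEAST n. \<exists>\<F>. covers_valid_edges k G \<F> \<and> card \<F> = n)"

lemma tree_width_attained:
  assumes "simple_graph G"
  shows "\<exists>(T :: nat ugraph) B. tree_decomposition G T B \<and> decomposition_width T B = tree_width G"
proof -
  define T :: "nat ugraph" where "T = \<lparr>verts = {0}, edges = {}\<rparr>"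
  have "\<not> is_cycle T p" for p
  proof
    assume p: "is_cycle T p"
    then have "0 < length p"
      by (auto simp: is_cycle_def)
    with p show False
      by (auto simp: is_cycle_def adj_def T_def)
  qed
  then have "is_tree T"
    by (simp add: is_tree_def simple_graph_def connected_graph_def acyclic_graph_def)
       (simp add: T_def)
  moreover have "\<forall>e\<in>edges G. e \<subseteq> verts G"
    using assms by (auto simp: simple_graph_def)
  ultimately have "tree_decomposition G T (\<lambda>_. verts G)"
    by (auto simp: tree_decomposition_def connected_graph_def induce_def T_def)
  then have "\<exists>w (T :: nat ugraph) B. tree_decomposition G T B \<and> decomposition_width T B = w"
    by blast
  then show ?thesis
    unfolding tree_width_def by (rule LeastI_ex)
qed

lemma strong_induced_arboricity_attained:
  assumes "simple_graph G"
  shows "\<exists>\<F>. covers_valid_edges k G \<F> \<and> card \<F> = strong_induced_arboricity k G"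
proof -
  have "{F. strong_forest k G F} \<subseteq> induce G ` Pow (verts G)"
    by (auto simp: strong_forest_def induced_subgraph_def)
  then have "finite {F. strong_forest k G F}"
    using assms by (auto simp: simple_graph_def intro: finite_subset)
  then have "covers_valid_edges k G {F. strong_forest k G F}"
    by (auto simp: covers_valid_edges_def valid_edge_def)
  then have "\<exists>n \<F>. covers_valid_edges k G \<F> \<and> card \<F> = n"
    by blast
  then show ?thesis
    unfolding strong_induced_arboricity_def by (rule LeastI_ex)
qed

end

theory Submission
  imports Defs
begin

text \<open>A graph of tree-width \<open>t\<close> has a proper colouring with \<open>t + 1\<close> colours in which any \<open>m + 1\<close>
  colours induce a graph of tree-width at most \<open>m\<close>. Two colours thus induce a forest, which
  gives the bound on \<open>f\<^sub>1\<close>.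

  For \<open>f\<^sub>2\<close>, an edge \<open>uv\<close> can only be 2-valid if some third vertex is adjacent to exactly one
  of \<open>u\<close> and \<open>v\<close>. The colours of these three vertices lie in a set of three colours, so it
  suffices to cover each of the \<open>t + 1 choose 3\<close> graphs of tree-width 2 that are induced by
  three colours with three forests. These come from a (not necessarily proper) colouring with
  colours 0, 1, 2 in which any two colours induce a forest and each edge \<open>uv\<close> as above has an
  adjacent edge such that the two edges together see at most two colours.

  Such a colouring exists by induction. If every edge lies in a triangle, a proper colouring
  works. Otherwise contract an edge \<open>xy\<close> that lies in no triangle and give both ends the
  colour of the contracted vertex. This fails only if the graph has a 4-cycle \<open>u, x, y, v\<close> where
  \<open>u\<close> and \<open>v\<close> have the same neighbours outside the cycle. Because there is no \<open>K\<^sub>4\<close> minor, only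
  the edges \<open>ux\<close> and \<open>vy\<close> then leave the component of \<open>x\<close> in the graph without \<open>u\<close> and \<open>v\<close>,
  and colourings of the two sides can be glued.\<close>

section \<open>Forests\<close>

text \<open>Acyclicity phrased as 1-degeneracy: each non-empty subset has a vertex with at most one
  neighbour inside it. In this form it passes to subsets at once and needs no handling of
  cycles.\<close>

definition forest :: "('a \<Rightarrow> 'a \<Rightarrow> bool) \<Rightarrow> 'a set \<Rightarrow> bool" where
  "forest A W \<longleftrightarrow> (\<forall>X\<subseteq>W. X \<noteq> {} \<longrightarrow> (\<exists>p\<in>X. \<forall>q\<in>X. \<forall>r\<in>X. A p q \<longrightarrow> A p r \<longrightarrow> q = r))"

lemma forestD:
  assumes "forest A W" "X \<subseteq> W" "X \<noteq> {}"
  obtains p where "p \<in> X" "\<And>q r. q \<in> X \<Longrightarrow> r \<in> X \<Longrightarrow> A p q \<Longrightarrow> A p r \<Longrightarrow> q = r"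
  using assms unfolding forest_def by meson

lemma forest_mono:
  assumes "forest A W" "W' \<subseteq> W" "\<And>p q. p \<in> W' \<Longrightarrow> q \<in> W' \<Longrightarrow> A' p q \<Longrightarrow> A p q"
  shows "forest A' W'"
  unfolding forest_def
proof (intro allI impI)
  fix X assume X: "X \<subseteq> W'" "X \<noteq> {}"
  then have "X \<subseteq> W" using assms(2) by blast
  with X obtain p where "p \<in> X" "\<And>q r. q \<in> X \<Longrightarrow> r \<in> X \<Longrightarrow> A p q \<Longrightarrow> A p r \<Longrightarrow> q = r"
    using forestD[OF assms(1)] by metis
  with X assms(3) show "\<exists>p\<in>X. \<forall>q\<in>X. \<forall>r\<in>X. A' p q \<longrightarrow> A' p r \<longrightarrow> q = r"
    by (meson subsetD)
qed

lemma forest_no_triangle: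
  assumes "forest A W" "symp A" "irreflp A" "a \<in> W" "b \<in> W" "d \<in> W" "A a b" "A b d" "A a d"
  shows False
proof -
  obtain p where p: "p \<in> {a, b, d}"
    "\<And>q r. q \<in> {a, b, d} \<Longrightarrow> r \<in> {a, b, d} \<Longrightarrow> A p q \<Longrightarrow> A p r \<Longrightarrow> q = r"
    using forestD[OF assms(1), of "{a, b, d}"] assms(4-6) by (metis empty_subsetI insert_not_empty insert_subset)
  have "a \<noteq> b" "b \<noteq> d" "a \<noteq> d" "A b a" "A d b" "A d a"
    using assms by (auto dest: sympD irreflpD)
  with p assms(7-9) show False by blast
qed

text \<open>A finite forest on two or more vertices has at least two vertices of degree at most one.
  If the first one found is \<open>a\<close>, then \<open>a\<close> is deleted and its only
  neighbour, if any, is avoided in the rest.\<close>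

lemma forest_leaf_avoiding:
  assumes "forest A W" "finite X" "X \<subseteq> W" "X \<noteq> {}" "X \<noteq> {a}" "symp A" "irreflp A"
  shows "\<exists>p\<in>X. p \<noteq> a \<and> (\<forall>q\<in>X. \<forall>r\<in>X. A p q \<longrightarrow> A p r \<longrightarrow> q = r)"
  using assms(2-5)
proof (induction "card X" arbitrary: X a rule: less_induct)
  case less
  obtain p where p: "p \<in> X" "\<And>q r. q \<in> X \<Longrightarrow> r \<in> X \<Longrightarrow> A p q \<Longrightarrow> A p r \<Longrightarrow> q = r"
    using forestD[OF assms(1)] less.prems by metis
  show ?case
  proof (cases "p = a")
    case False
    then show ?thesis using p by blast
  next
    case True
    let ?Y = "X - {a}"
    have Y: "finite ?Y" "?Y \<subseteq> W" "?Y \<noteq> {}"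
      using less.prems p True by auto
    have "card ?Y < card X" using less.prems p True by (intro card_Diff1_less) auto
    show ?thesis
    proof (cases "\<exists>b\<in>X. A a b")
      case False
      obtain p' where p': "p' \<in> ?Y" "\<And>q r. q \<in> ?Y \<Longrightarrow> r \<in> ?Y \<Longrightarrow> A p' q \<Longrightarrow> A p' r \<Longrightarrow> q = r"
        using forestD[OF assms(1) Y(2,3)] by metis
      moreover have "\<not> A p' a" using False p'(1) assms(6) by (auto dest: sympD)
      ultimately show ?thesis by (intro bexI[of _ p']) auto
    next
      case True
      then obtain b where b: "b \<in> X" "A a b" by blast
      have ab: "a \<noteq> b" using b assms(7) by (auto dest: irreflpD)
      \<comment> \<open>Deleting \<open>a\<close> changes no degree but that of \<open>b\<close>, so
        a leaf of \<open>?Y\<close> other than \<open>b\<close> is also a leaf of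
        \<open>X\<close>.\<close>
      have uniq: "q = b" if "q \<in> X" "A q a" for q
        using p(2)[of q b] that b \<open>p = a\<close> assms(6) by (auto dest: sympD)
      show ?thesis
      proof (cases "?Y = {b}")
        case True
        then have "X = {a, b}" using p(1) \<open>p = a\<close> by auto
        then show ?thesis using ab assms(7) by (intro bexI[of _ b]) (auto dest: irreflpD)
      next
        case False
        obtain p' where "p' \<in> ?Y" "p' \<noteq> b" "\<forall>q\<in>?Y. \<forall>r\<in>?Y. A p' q \<longrightarrow> A p' r \<longrightarrow> q = r"
          using less.hyps[OF \<open>card ?Y < card X\<close> Y False] by blast
        then show ?thesis using uniq by (intro bexI[of _ p']) auto
      qed
    qed
  qed
qed

text \<open>Only the edge \<open>ab\<close> can join the two parts. A leaf of
  \<open>X \<inter> W1\<close> other than \<open>a\<close> has no neighbour in \<open>W2\<close>, so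
  it is a leaf of \<open>X\<close>; likewise for \<open>W2\<close> and \<open>b\<close>. If neither
  exists, \<open>X\<close> has no vertices besides \<open>a\<close> and \<open>b\<close>.\<close>

lemma forest_bridge:
  assumes W: "forest A W1" "forest A W2" and fin: "finite W1" "finite W2" and A: "symp A" "irreflp A"
    and bridge: "\<And>p q. p \<in> W1 \<Longrightarrow> q \<in> W2 \<Longrightarrow> A p q \<Longrightarrow> p = a \<and> q = b"
  shows "forest A (W1 \<union> W2)"
  unfolding forest_def
proof (intro allI impI)
  fix X assume X: "X \<subseteq> W1 \<union> W2" "X \<noteq> {}"
  let ?goal = "\<exists>p\<in>X. \<forall>q\<in>X. \<forall>r\<in>X. A p q \<longrightarrow> A p r \<longrightarrow> q = r"
  have leaf1: ?goal if ne: "X \<inter> W1 \<noteq> {}" "X \<inter> W1 \<noteq> {a}"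
  proof -
    obtain p where p: "p \<in> X \<inter> W1" "p \<noteq> a"
      "\<forall>q\<in>X \<inter> W1. \<forall>r\<in>X \<inter> W1. A p q \<longrightarrow> A p r \<longrightarrow> q = r"
      using forest_leaf_avoiding[OF W(1) _ _ ne A] fin by blast
    have "q \<in> W1" if "q \<in> X" "A p q" for q
      using p(1,2) bridge[of p q] that X by auto
    with p show ?thesis by (intro bexI[of _ p]) auto
  qed
  have leaf2: ?goal if ne: "X \<inter> W2 \<noteq> {}" "X \<inter> W2 \<noteq> {b}"
  proof -
    obtain p where p: "p \<in> X \<inter> W2" "p \<noteq> b"
      "\<forall>q\<in>X \<inter> W2. \<forall>r\<in>X \<inter> W2. A p q \<longrightarrow> A p r \<longrightarrow> q = r"
      using forest_leaf_avoiding[OF W(2) _ _ ne A] fin by blast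
    have "q \<in> W2" if "q \<in> X" "A p q" for q
      using p(1,2) bridge[of q p] that X A(1) by (auto dest: sympD)
    with p show ?thesis by (intro bexI[of _ p]) auto
  qed
  have small: ?goal if "X \<inter> W1 \<subseteq> {a}" "X \<inter> W2 \<subseteq> {b}"
  proof -
    have "X \<subseteq> {a, b}" using that X by blast
    moreover have "\<not> A p p" for p using A(2) by (auto dest: irreflpD)
    ultimately show ?thesis using X(2) by blast
  qed
  show ?goal using leaf1 leaf2 small by blast
qed

section \<open>Elimination orderings\<close>

text \<open>The relation \<open>B\<close> is the fill-in: it contains \<open>A\<close>, and the earlier neighbours of each
  vertex form a clique in it.\<close>

inductive elim_width :: "nat \<Rightarrow> 'a set \<Rightarrow> ('a \<Rightarrow> 'a \<Rightarrow> bool) \<Rightarrow> bool" for k where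
  empty: "elim_width k {} A"
| insert: "\<lbrakk>elim_width k V B; v \<notin> V; N \<subseteq> V; finite N; card N \<le> k;
     \<And>p q. p \<in> N \<Longrightarrow> q \<in> N \<Longrightarrow> p \<noteq> q \<Longrightarrow> B p q;
     \<And>p q. p \<in> V \<Longrightarrow> q \<in> V \<Longrightarrow> p \<noteq> q \<Longrightarrow> A p q \<Longrightarrow> B p q;
     \<And>p. p \<in> V \<Longrightarrow> A v p \<or> A p v \<Longrightarrow> p \<in> N\<rbrakk> \<Longrightarrow> elim_width k (insert v V) A"

text \<open>The same ordering serves after deleting vertices and edges and renaming injectively. The
  renaming is needed for contractions, where a vertex may have to take over the name of
  another.\<close>

lemma elim_width_image:
  assumes "elim_width k V A" "W \<subseteq> V" "inj_on f W"
    and "\<And>p q. p \<in> W \<Longrightarrow> q \<in> W \<Longrightarrow> p \<noteq> q \<Longrightarrow> A' (f p) (f q) \<Longrightarrow> A p q"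
  shows "elim_width k (f ` W) A'"
  using assms
proof (induction arbitrary: W A' rule: elim_width.induct)
  case (empty A)
  then show ?case by (simp add: elim_width.empty)
next
  case (insert V B v N A)
  let ?U = "W - {v}"
  \<comment> \<open>The push-forward of the fill-in, restricted to images of vertices other than
    \<open>v\<close>.\<close>
  define B' where "B' = (\<lambda>p q. \<exists>p0\<in>?U. \<exists>q0\<in>?U. p = f p0 \<and> q = f q0 \<and> B p0 q0)"
  have U: "?U \<subseteq> V" using insert.prems(1) by blast
  have inj: "inj_on f ?U" using insert.prems(2) by (rule inj_on_subset) auto
  have IH: "elim_width k (f ` ?U) B'"
  proof (rule insert.IH[OF U inj])
    fix p q assume pq: "p \<in> ?U" "q \<in> ?U" "B' (f p) (f q)"
    then show "B p q" unfolding B'_def using inj by (auto dest: inj_onD)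
  qed
  have AB: "B' (f p) (f q)" if "p \<in> ?U" "q \<in> ?U" "p \<noteq> q" "A' (f p) (f q)" for p q
  proof -
    have "A p q" using insert.prems(3) that by blast
    then have "B p q" using insert.hyps(7) that U by blast
    then show ?thesis using that unfolding B'_def by blast
  qed
  show ?case
  proof (cases "v \<in> W")
    case False
    then have "?U = W" by blast
    have "elim_width k (f ` ?U) A'"
    proof (rule insert.IH[OF U inj])
      fix p q assume "p \<in> ?U" "q \<in> ?U" "p \<noteq> q" "A' (f p) (f q)"
      then show "B p q" using AB inj insert.hyps(7) insert.prems(3) U by (meson DiffD1 subsetD)
    qed
    then show ?thesis using \<open>?U = W\<close> by simp
  next
    case True
    then have W: "f ` W = insert (f v) (f ` ?U)" by blast
    show ?thesis unfolding W
    proof (rule elim_width.insert[OF IH, of _ "f ` (N \<inter> W)"])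
      show "f v \<notin> f ` ?U" using insert.prems(2) True by (auto dest: inj_onD)
      show "f ` (N \<inter> W) \<subseteq> f ` ?U" using insert.hyps(2,3) by auto
      show "finite (f ` (N \<inter> W))" using insert.hyps(4) by blast
      show "card (f ` (N \<inter> W)) \<le> k"
        using insert.hyps(4,5) by (meson card_image_le card_mono finite_Int inf_le1 order_trans)
      show "B' p q" if "p \<in> f ` (N \<inter> W)" "q \<in> f ` (N \<inter> W)" "p \<noteq> q" for p q
        using that insert.hyps(2,3,6) unfolding B'_def by blast
      show "B' p q" if "p \<in> f ` ?U" "q \<in> f ` ?U" "p \<noteq> q" "A' p q" for p q
        using that AB by blast
      show "p \<in> f ` (N \<inter> W)" if p: "p \<in> f ` ?U" "A' (f v) p \<or> A' p (f v)" for p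
      proof -
        obtain p0 where p0: "p = f p0" "p0 \<in> ?U" using p by blast
        then have "A v p0 \<or> A p0 v" using p insert.prems(3) True by blast
        then show ?thesis using p0 insert.hyps(8) U by blast
      qed
    qed
  qed
qed

lemma elim_width_mono:
  assumes "elim_width k V A" "W \<subseteq> V" "\<And>p q. p \<in> W \<Longrightarrow> q \<in> W \<Longrightarrow> p \<noteq> q \<Longrightarrow> A' p q \<Longrightarrow> A p q"
  shows "elim_width k W A'"
proof -
  have "elim_width k (id ` W) A'"
    using assms(3) by (intro elim_width_image[OF assms(1,2)]) simp_all
  then show ?thesis by simp
qed

text \<open>The vertex of the clique that is last in the ordering has all the others among its at
  most \<open>k\<close> earlier neighbours.\<close>

lemma elim_width_clique:
  assumes "elim_width k V A" "S \<subseteq> V" "finite S" "\<And>p q. p \<in> S \<Longrightarrow> q \<in> S \<Longrightarrow> p \<noteq> q \<Longrightarrow> A p q"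
  shows "card S \<le> Suc k"
  using assms
proof (induction rule: elim_width.induct)
  case (empty A)
  then show ?case by simp
next
  case (insert V B v N A)
  show ?case
  proof (cases "v \<in> S")
    case True
    have "S - {v} \<subseteq> N" using insert.hyps(8) insert.prems True by blast
    then have "card (S - {v}) \<le> k" using insert.hyps(4,5) by (meson card_mono order_trans)
    then show ?thesis using True insert.prems(2) by (simp add: card_Diff_singleton)
  next
    case False
    have "S \<subseteq> V" using insert.prems(1) False by blast
    show ?thesis
    proof (rule insert.IH[OF \<open>S \<subseteq> V\<close> insert.prems(2)])
      show "B p q" if "p \<in> S" "q \<in> S" "p \<noteq> q" for p q
        using that insert.hyps(7) insert.prems(3) \<open>S \<subseteq> V\<close> by (meson subsetD)
    qed
  qed
qed

text \<open>\<open>y\<close> is merged into \<open>x\<close>, but not cut off: it is removed from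
  the vertex set separately. The clause \<open>p \<noteq> q\<close> suppresses the loop that the
  contracted edge would leave at \<open>x\<close>.\<close>

definition contract :: "('a \<Rightarrow> 'a \<Rightarrow> bool) \<Rightarrow> 'a \<Rightarrow> 'a \<Rightarrow> 'a \<Rightarrow> 'a \<Rightarrow> bool" where
  "contract A x y p q \<longleftrightarrow> p \<noteq> q \<and> (A p q \<or> p = x \<and> A y q \<or> q = x \<and> A p y)"

lemma symp_contract: "symp A \<Longrightarrow> symp (contract A x y)"
  unfolding symp_def contract_def by blast

lemma irreflp_contract: "irreflp (contract A x y)"
  by (simp add: irreflp_def contract_def)

text \<open>If the last vertex is not an end of the edge, the fill-in is contracted too, and the
  clique \<open>N\<close> is mapped to a clique. If it is one end, the other end lies in
  \<open>N\<close> and is joined in \<open>B\<close> to the rest of \<open>N\<close>, so the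
  contracted graph embeds in the fill-in of the earlier vertices.\<close>

lemma elim_width_contract:
  assumes "elim_width k V A" "x \<in> V" "y \<in> V" "x \<noteq> y" "A x y" "A y x"
  shows "elim_width k (V - {y}) (contract A x y)"
  using assms
proof (induction rule: elim_width.induct)
  case (empty A)
  then show ?case by simp
next
  case (insert V B v N A)
  consider "x \<in> V" "y \<in> V" | "x = v" "y \<in> V" | "y = v" "x \<in> V"
    using insert.prems by blast
  then show ?case
  proof cases
    case 1
    then have "v \<noteq> x" "v \<noteq> y" using insert.hyps(2) by auto
    let ?f = "\<lambda>p. if p = y then x else p"
    have IH: "elim_width k (V - {y}) (contract B x y)"
      using insert.IH insert.hyps(7) insert.prems 1 by blast
    have "elim_width k (insert v (V - {y})) (contract A x y)"
    proof (rule elim_width.insert[OF IH, of _ "?f ` N"])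
      show "v \<notin> V - {y}" using insert.hyps(2) by blast
      show "?f ` N \<subseteq> V - {y}" using insert.hyps(3) 1 insert.prems(3) by auto
      show "finite (?f ` N)" using insert.hyps(4) by blast
      show "card (?f ` N) \<le> k" using insert.hyps(4,5) card_image_le order_trans by blast
      show "contract B x y p q" if "p \<in> ?f ` N" "q \<in> ?f ` N" "p \<noteq> q" for p q
        using that insert.hyps(6) unfolding contract_def by (auto split: if_splits)
      show "contract B x y p q" if "p \<in> V - {y}" "q \<in> V - {y}" "p \<noteq> q" "contract A x y p q" for p q
        using that insert.hyps(7) 1 unfolding contract_def by blast
      show "p \<in> ?f ` N" if "p \<in> V - {y}" "contract A x y v p \<or> contract A x y p v" for p
      proof -
        have "A v p \<or> A p v \<or> p = x \<and> (A v y \<or> A y v)"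
          using that \<open>v \<noteq> x\<close> unfolding contract_def by blast
        then have "p \<in> N \<or> p = x \<and> y \<in> N" using insert.hyps(8) that 1 by blast
        then show ?thesis using that by (auto intro: image_eqI[of _ _ p] image_eqI[of _ _ y])
      qed
    qed
    moreover have "insert v V - {y} = insert v (V - {y})" using \<open>v \<noteq> y\<close> by blast
    ultimately show ?thesis by simp
  next
    case 2
    have yN: "y \<in> N" using insert.hyps(8) insert.prems 2 by blast
    \<comment> \<open>The merged vertex is called \<open>x = v\<close>, but in the ordering of
      \<open>V\<close> it takes the place of \<open>y\<close>.\<close>
    have V: "insert v V - {y} = (\<lambda>p. if p = y then v else p) ` V"
      using 2 insert.prems(3) by auto
    show ?thesis unfolding V
    proof (rule elim_width_image[OF insert.hyps(1) order_refl])
      show "inj_on (\<lambda>p. if p = y then v else p) V"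
        using insert.hyps(2) by (auto simp: inj_on_def split: if_splits)
      fix p q assume pq: "p \<in> V" "q \<in> V" "p \<noteq> q"
        "contract A x y (if p = y then v else p) (if q = y then v else q)"
      have "p \<noteq> v" "q \<noteq> v" using pq insert.hyps(2) by auto
      with pq have "A p q \<or> p = y \<and> A v q \<or> q = y \<and> A p v"
        unfolding contract_def using 2 by (auto split: if_splits)
      then show "B p q" using pq insert.hyps(6-8) yN by blast
    qed
  next
    case 3
    have xN: "x \<in> N" using insert.hyps(8) insert.prems 3 by blast
    have "insert v V - {y} \<subseteq> V" using 3 by blast
    then show ?thesis
    proof (rule elim_width_mono[OF insert.hyps(1)])
      fix p q assume pq: "p \<in> insert v V - {y}" "q \<in> insert v V - {y}" "p \<noteq> q" "contract A x y p q"
      then show "B p q" using insert.hyps(6-8) xN 3 unfolding contract_def by blast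
    qed
  qed
qed

text \<open>In any \<open>X\<close>, the vertex that is last in the ordering has at most one
  neighbour.\<close>

lemma elim_width_1_forest:
  assumes "elim_width 1 V A" "symp A" "irreflp A"
  shows "forest A V"
proof -
  \<comment> \<open>The conditions \<open>p \<noteq> q\<close> and \<open>p \<noteq> r\<close> are
    added because the fill-in, to which the induction hypothesis applies, need not be
    irreflexive.\<close>
  have *: "\<exists>p\<in>X. \<forall>q\<in>X. \<forall>r\<in>X. A p q \<and> p \<noteq> q \<longrightarrow> A p r \<and> p \<noteq> r \<longrightarrow> q = r" if "X \<subseteq> V" "X \<noteq> {}" for X
    using assms(1) that
  proof (induction arbitrary: X rule: elim_width.induct)
    case (empty A)
    then show ?case by simp
  next
    case (insert V B v N A)
    show ?case
    proof (cases "v \<in> X")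
      case True
      have "q \<in> N" if "q \<in> X" "A v q" "v \<noteq> q" for q
        using insert.hyps(8) insert.prems that by blast
      then show ?thesis using True insert.hyps(4,5)
        by (intro bexI[of _ v]) (auto simp: card_le_Suc0_iff_eq)
    next
      case False
      then have X: "X \<subseteq> V" using insert.prems by blast
      obtain p where p: "p \<in> X" "\<forall>q\<in>X. \<forall>r\<in>X. B p q \<and> p \<noteq> q \<longrightarrow> B p r \<and> p \<noteq> r \<longrightarrow> q = r"
        using insert.IH[OF X insert.prems(2)] by blast
      have "B p q" if "q \<in> X" "A p q" "p \<noteq> q" for q
        using insert.hyps(7) p(1) that X by blast
      with p show ?thesis by blast
    qed
  qed
  have irr: "A p q \<and> p \<noteq> q \<longleftrightarrow> A p q" for p q using assms(3) by (auto dest: irreflpD)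
  show ?thesis unfolding forest_def using *[unfolded irr] by simp
qed

text \<open>Greedy colouring: at most \<open>k\<close> of the \<open>k + 1\<close> colours occur on
  \<open>N\<close>. As \<open>N\<close> is a clique of the fill-in, its colours are distinct; so if
  the colour of \<open>v\<close> lies in \<open>I\<close>, at most \<open>m\<close> vertices of
  \<open>N\<close> use the \<open>m\<close> other colours of \<open>I\<close>.\<close>

lemma elim_width_colouring:
  assumes "elim_width k V A"
  obtains c :: "'a \<Rightarrow> nat" where "\<And>v. v \<in> V \<Longrightarrow> c v \<le> k"
    and "\<And>p q. p \<in> V \<Longrightarrow> q \<in> V \<Longrightarrow> p \<noteq> q \<Longrightarrow> A p q \<Longrightarrow> c p \<noteq> c q"
    and "\<And>I m. finite I \<Longrightarrow> card I = Suc m \<Longrightarrow> elim_width m {v\<in>V. c v \<in> I} A"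
proof -
  have "\<exists>c :: 'a \<Rightarrow> nat. (\<forall>v\<in>V. c v \<le> k) \<and> (\<forall>p\<in>V. \<forall>q\<in>V. p \<noteq> q \<longrightarrow> A p q \<longrightarrow> c p \<noteq> c q) \<and>
    (\<forall>I m. finite I \<longrightarrow> card I = Suc m \<longrightarrow> elim_width m {v\<in>V. c v \<in> I} A)"
    using assms
  proof (induction rule: elim_width.induct)
    case (empty A)
    then show ?case by (auto intro: elim_width.empty)
  next
    case (insert V B v N A)
    then obtain c :: "'a \<Rightarrow> nat" where c: "\<forall>v\<in>V. c v \<le> k"
      "\<forall>p\<in>V. \<forall>q\<in>V. p \<noteq> q \<longrightarrow> B p q \<longrightarrow> c p \<noteq> c q"
      "\<And>I m. finite I \<Longrightarrow> card I = Suc m \<Longrightarrow> elim_width m {v\<in>V. c v \<in> I} B" by blast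
    have "card (c ` N) < card {..k}"
      using insert.hyps(4,5) using card_image_le[of N c] by simp
    then have "\<not> {..k} \<subseteq> c ` N" using insert.hyps(4) by (meson card_mono finite_imageI leD)
    then obtain j where j: "j \<le> k" "j \<notin> c ` N" by auto
    define d where "d = c(v := j)"
    have d: "d v = j" "\<And>p. p \<in> V \<Longrightarrow> d p = c p" using insert.hyps(2) by (auto simp: d_def)
    have sub: "elim_width m {w\<in>insert v V. d w \<in> I} A" if I: "finite I" "card I = Suc m" for I m
    proof (cases "j \<in> I")
      case False
      then have "{w\<in>insert v V. d w \<in> I} = {w\<in>V. c w \<in> I}" using d by auto
      then show ?thesis using elim_width_mono[OF c(3)[OF I] order_refl] insert.hyps(7) by simp
    next
      case True
      then have *: "{w\<in>insert v V. d w \<in> I} = insert v {w\<in>V. c w \<in> I}" using d by auto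
      show ?thesis unfolding *
      proof (rule elim_width.insert[OF c(3)[OF I], of _ "{w\<in>N. c w \<in> I}"])
        have inj: "inj_on c {w\<in>N. c w \<in> I}" unfolding inj_on_def using c(2) insert.hyps(3,6) by blast
        have "c ` {w\<in>N. c w \<in> I} \<subseteq> I - {j}" using j by auto
        then have "card (c ` {w\<in>N. c w \<in> I}) \<le> card (I - {j})" using I by (intro card_mono) auto
        then show "card {w\<in>N. c w \<in> I} \<le> m" using inj I True by (simp add: card_image)
      qed (use insert.hyps in auto)
    qed
    have "d p \<noteq> d q" if pq: "p \<in> insert v V" "q \<in> insert v V" "p \<noteq> q" "A p q" for p q
    proof (cases "p = v \<or> q = v")
      case True
      then show ?thesis using pq insert.hyps(8) j d by (metis image_eqI insertE)
    next
      case False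
      then show ?thesis using pq c(2) d(2) insert.hyps(7) by (metis insertE)
    qed
    then show ?case using c(1) d j sub by (intro exI[of _ d]) auto
  qed
  then obtain c :: "'a \<Rightarrow> nat" where "\<forall>v\<in>V. c v \<le> k"
    "\<forall>p\<in>V. \<forall>q\<in>V. p \<noteq> q \<longrightarrow> A p q \<longrightarrow> c p \<noteq> c q"
    "\<forall>I m. finite I \<longrightarrow> card I = Suc m \<longrightarrow> elim_width m {v\<in>V. c v \<in> I} A" by (elim exE conjE)
  then show ?thesis by (intro that[of c]) simp_all
qed

section \<open>Separation of common neighbours\<close>

lemma rtrancl_contract:
  assumes "(a, b) \<in> {(a, b). a \<in> U \<and> b \<in> U \<and> A a b}\<^sup>*" "x \<in> U" "x \<noteq> y"
  shows "((if a = y then x else a), (if b = y then x else b)) \<in>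
    {(a, b). a \<in> U - {y} \<and> b \<in> U - {y} \<and> contract A x y a b}\<^sup>*"
  (is "(?f a, ?f b) \<in> ?R\<^sup>*")
  using assms(1)
proof (induction rule: rtrancl_induct)
  case base
  show ?case by simp
next
  case (step b d)
  have "?f b = ?f d \<or> (?f b, ?f d) \<in> ?R"
    using step.hyps(2) assms(2,3) unfolding contract_def by auto
  then show ?case
  proof
    assume "?f b = ?f d"
    then show ?thesis using step.IH by simp
  next
    assume "(?f b, ?f d) \<in> ?R"
    then show ?thesis using step.IH by (rule rtrancl_into_rtrancl[rotated])
  qed
qed

text \<open>Contracting a path from \<open>p\<close> to \<open>q\<close> would produce a complete graph on four vertices.\<close>

lemma common_neighbours_separated:
  assumes "elim_width 2 V A" "finite V" "symp A" "irreflp A" "u \<in> V" "v \<in> V" "u \<noteq> v" "A u v" "p \<noteq> q"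
    "A u p" "A v p" "A u q" "A v q" "p \<in> V - {u, v}" "q \<in> V - {u, v}"
  shows "(p, q) \<notin> {(a, b). a \<in> V - {u, v} \<and> b \<in> V - {u, v} \<and> A a b}\<^sup>*"
  using assms
proof (induction "card V" arbitrary: V A rule: less_induct)
  case less
  note sym = sympD[OF less.prems(3)]
  show ?case
  proof
    assume "(p, q) \<in> {(a, b). a \<in> V - {u, v} \<and> b \<in> V - {u, v} \<and> A a b}\<^sup>*"
    then obtain r where r: "r \<in> V - {u, v}" "A p r"
      "(r, q) \<in> {(a, b). a \<in> V - {u, v} \<and> b \<in> V - {u, v} \<and> A a b}\<^sup>*"
      using \<open>p \<noteq> q\<close> by (auto elim: converse_rtranclE)
    have "A q u" "A q v" "A p u" "A p v" "A r p" "A v u"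
      using less.prems r sym by blast+
    show False
    proof (cases "r = q")
      case True
      \<comment> \<open>The four vertices form a clique, but in width two a clique has at most
        three.\<close>
      have "card {u, v, p, q} \<le> Suc 2"
      proof (rule elim_width_clique[OF less.prems(1)])
        show "A a b" if "a \<in> {u, v, p, q}" "b \<in> {u, v, p, q}" "a \<noteq> b" for a b
          using that less.prems sym r True \<open>A p r\<close> \<open>A r p\<close> by blast
      qed (use less.prems in auto)
      moreover have "card {u, v, p, q} = 4" using less.prems by auto
      ultimately show False by simp
    next
      case False
      have "r \<noteq> p" using \<open>A p r\<close> less.prems(4) by (auto dest: irreflpD)
      \<comment> \<open>Contracting \<open>pr\<close> onto \<open>p\<close> keeps \<open>p\<close>
        and \<open>q\<close> connected and gives a smaller graph satisfying the hypotheses.\<close>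
      let ?f = "\<lambda>a. if a = r then p else a"
      let ?A = "contract A p r" and ?V = "V - {r}"
      let ?R = "{(a, b). a \<in> ?V - {u, v} \<and> b \<in> ?V - {u, v} \<and> ?A a b}"
      have "?V - {u, v} = V - {u, v} - {r}" by blast
      then have "(?f r, ?f q) \<in> ?R\<^sup>*"
        using rtrancl_contract[OF r(3), of p r] less.prems \<open>r \<noteq> p\<close> by simp
      then have "(p, q) \<in> ?R\<^sup>*" using False by (simp split: if_splits)
      moreover have "(p, q) \<notin> ?R\<^sup>*"
      proof (rule less.hyps)
        show "elim_width 2 ?V ?A"
          using elim_width_contract[OF less.prems(1)] less.prems r \<open>r \<noteq> p\<close> \<open>A r p\<close> by blast
        show "card ?V < card V" using r less.prems by (intro card_Diff1_less) auto
        show "symp ?A" using less.prems by (intro symp_contract)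
        show "irreflp ?A" by (rule irreflp_contract)
      qed (use less.prems r False \<open>r \<noteq> p\<close> in \<open>auto simp: contract_def\<close>)
      ultimately show False by blast
    qed
  qed
qed

section \<open>Good colourings of graphs of width two\<close>

text \<open>For an edge \<open>uv\<close> of a simple graph: some third vertex spans an induced path
  of two edges with \<open>u\<close> and \<open>v\<close>. Otherwise \<open>u\<close> and
  \<open>v\<close> have the same neighbours elsewhere.\<close>

definition distinguished :: "'a set \<Rightarrow> ('a \<Rightarrow> 'a \<Rightarrow> bool) \<Rightarrow> 'a \<Rightarrow> 'a \<Rightarrow> bool" where
  "distinguished V A u v \<longleftrightarrow> (\<exists>w\<in>V. w \<noteq> u \<and> w \<noteq> v \<and> A u w \<noteq> A v w)"

text \<open>The last disjunction says that \<open>u\<close>, \<open>v\<close>, \<open>w\<close>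
  carry at most two colours. With three colours in all, one class can then be deleted without
  destroying \<open>uv\<close> or the edge to \<open>w\<close>.\<close>

definition accompanied :: "'a set \<Rightarrow> ('a \<Rightarrow> 'a \<Rightarrow> bool) \<Rightarrow> ('a \<Rightarrow> nat) \<Rightarrow> 'a \<Rightarrow> 'a \<Rightarrow> bool" where
  "accompanied V A c u v \<longleftrightarrow> (\<exists>w\<in>V. w \<noteq> u \<and> w \<noteq> v \<and> (A u w \<or> A v w) \<and>
     (c u = c v \<or> c w = c u \<or> c w = c v))"

definition good_colouring :: "'a set \<Rightarrow> ('a \<Rightarrow> 'a \<Rightarrow> bool) \<Rightarrow> ('a \<Rightarrow> nat) \<Rightarrow> bool" where
  "good_colouring V A c \<longleftrightarrow> (\<forall>v\<in>V. c v < 3) \<and> (\<forall>m<3. forest A {v\<in>V. c v \<noteq> m}) \<and>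
     (\<forall>u\<in>V. \<forall>v\<in>V. A u v \<longrightarrow> distinguished V A u v \<longrightarrow> accompanied V A c u v)"

lemma accompanied_commute: "accompanied V A c u v \<longleftrightarrow> accompanied V A c v u"
  unfolding accompanied_def by (intro bex_cong) auto

text \<open>A triangle missing a colour \<open>m\<close> would lie in the forest that avoids
  \<open>m\<close>. So its three colours are distinct, and the colours can be permuted.\<close>

lemma good_colouring_normalise:
  assumes "good_colouring V A c" "symp A" "irreflp A" "a \<in> V" "b \<in> V" "d \<in> V" "A a b" "A b d" "A a d"
  obtains c' where "good_colouring V A c'" "c' a = 0" "c' b = 1" "c' d = 2"
proof -
  have lt: "c p < 3" if "p \<in> V" for p using assms(1) that by (auto simp: good_colouring_def)
  have distinct: "\<not> (c a \<noteq> m \<and> c b \<noteq> m \<and> c d \<noteq> m)" if "m < 3" for m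
  proof
    assume m: "c a \<noteq> m \<and> c b \<noteq> m \<and> c d \<noteq> m"
    have "forest A {v\<in>V. c v \<noteq> m}" using assms(1) that by (auto simp: good_colouring_def)
    then show False
      using forest_no_triangle[OF _ assms(2,3), of "{v\<in>V. c v \<noteq> m}" a b d] assms(4-9) m by blast
  qed
  have abd: "c a \<noteq> c b" "c b \<noteq> c d" "c a \<noteq> c d"
    using distinct[of 0] distinct[of 1] distinct[of 2] by auto
  define f where "f = (\<lambda>m. if m = c a then 0 else if m = c b then 1 else 2 :: nat)"
  have f: "f m = f n \<longleftrightarrow> m = n" if "m < 3" "n < 3" for m n
    using that abd lt[OF assms(4)] lt[OF assms(5)] lt[OF assms(6)] unfolding f_def by auto
  have fa: "f (c a) = 0" "f (c b) = 1" "f (c d) = 2" using abd by (auto simp: f_def)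
  have surj: "\<exists>n<3. f n = m" if "m < 3" for m
  proof -
    have "m = 0 \<or> m = 1 \<or> m = 2" using that by auto
    then show ?thesis using fa lt assms(4-6) by metis
  qed
  have "good_colouring V A (f \<circ> c)"
    unfolding good_colouring_def
  proof (intro conjI allI ballI impI)
    show "(f \<circ> c) v < 3" for v by (simp add: f_def)
    fix m :: nat assume "m < 3"
    then obtain n where n: "n < 3" "f n = m" using surj by blast
    then have "{v\<in>V. (f \<circ> c) v \<noteq> m} = {v\<in>V. c v \<noteq> n}" using f lt by auto
    then show "forest A {v\<in>V. (f \<circ> c) v \<noteq> m}"
      using assms(1) n by (auto simp: good_colouring_def)
  next
    fix u v assume "u \<in> V" "v \<in> V" "A u v" "distinguished V A u v"
    then have "accompanied V A c u v" using assms(1) by (auto simp: good_colouring_def)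
    then show "accompanied V A (f \<circ> c) u v" unfolding accompanied_def by auto
  qed
  with that fa show ?thesis by simp
qed

text \<open>A proper colouring with three colours in which two colours span width one, hence a
  forest. Let \<open>w\<close> be adjacent to \<open>u\<close> but not to \<open>v\<close>. Either
  \<open>w\<close> has the colour of \<open>v\<close>, or the third vertex \<open>r\<close> of a
  triangle on \<open>uw\<close> has it.\<close>

lemma good_colouring_triangulated:
  assumes "elim_width 2 V A" "symp A" "irreflp A"
    and tri: "\<And>p q. p \<in> V \<Longrightarrow> q \<in> V \<Longrightarrow> A p q \<Longrightarrow> \<exists>r\<in>V. A p r \<and> A q r"
  shows "\<exists>c. good_colouring V A c"
proof -
  obtain c :: "'a \<Rightarrow> nat" where c: "\<And>v. v \<in> V \<Longrightarrow> c v \<le> 2"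
    "\<And>p q. p \<in> V \<Longrightarrow> q \<in> V \<Longrightarrow> p \<noteq> q \<Longrightarrow> A p q \<Longrightarrow> c p \<noteq> c q"
    "\<And>I m. finite I \<Longrightarrow> card I = Suc m \<Longrightarrow> elim_width m {v\<in>V. c v \<in> I} A"
    using elim_width_colouring[OF assms(1)] by blast
  have proper: "c p \<noteq> c q" if "p \<in> V" "q \<in> V" "A p q" for p q
    using c(2) that assms(3) by (metis irreflpD)
  note sym = sympD[OF assms(2)]
  have "forest A {v\<in>V. c v \<noteq> m}" if "m < 3" for m
  proof -
    have "card ({..2} - {m}) = Suc 1" using that by simp
    then have "elim_width 1 {v\<in>V. c v \<in> {..2} - {m}} A" by (intro c(3)) auto
    moreover have "{v\<in>V. c v \<in> {..2} - {m}} = {v\<in>V. c v \<noteq> m}" using c(1) by auto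
    ultimately show ?thesis using elim_width_1_forest assms(2,3) by metis
  qed
  moreover have acc: "accompanied V A c u v"
    if uv: "u \<in> V" "v \<in> V" "A u v" "w \<in> V" "w \<noteq> v" "A u w" "\<not> A v w" for u v w
  proof (cases "c w = c v")
    case True
    then show ?thesis using uv assms(3) by (auto simp: accompanied_def dest: irreflpD)
  next
    case False
    obtain r where r: "r \<in> V" "A u r" "A w r" using tri[of u w] uv by blast
    have "c u \<noteq> c v" "c u \<noteq> c w" "c u \<noteq> c r" "c w \<noteq> c r" using proper uv r by auto
    then have "c r = c v" using False c(1)[of u] c(1)[of v] c(1)[of w] c(1)[of r] uv r by linarith
    \<comment> \<open>\<open>w\<close> is adjacent to \<open>r\<close> but not to
      \<open>v\<close>.\<close>
    moreover have "r \<noteq> v" "r \<noteq> u" using uv r sym assms(3) by (auto dest: irreflpD)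
    ultimately show ?thesis using r by (auto simp: accompanied_def)
  qed
  have "accompanied V A c u v" if uv: "u \<in> V" "v \<in> V" "A u v" "distinguished V A u v" for u v
  proof -
    obtain w where w: "w \<in> V" "w \<noteq> u" "w \<noteq> v" "A u w \<noteq> A v w"
      using uv by (auto simp: distinguished_def)
    show ?thesis
    proof (cases "A u w")
      case True
      then show ?thesis using acc[of u v w] uv w by blast
    next
      case False
      then show ?thesis using acc[of v u w] uv w sym accompanied_commute by metis
    qed
  qed
  ultimately show ?thesis using c(1) unfolding good_colouring_def
    by (intro exI[of _ c]) (auto simp: less_Suc_eq_le numeral_3_eq_3 numeral_2_eq_2)
qed

text \<open>A leaf of the contracted set is pulled back. Away from the merged vertex its neighbours
  stay distinct, since no vertex of \<open>W\<close> is adjacent to both \<open>x\<close> and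
  \<open>y\<close>. At the merged vertex, a further neighbour of \<open>x\<close> and one of
  \<open>y\<close> would have to coincide, which is excluded for the same reason.\<close>

lemma forest_contract:
  assumes "symp A" "irreflp A" "A x y" and free: "\<And>p. p \<in> W \<Longrightarrow> \<not> (A p x \<and> A p y)"
    and xy: "x \<in> W \<longleftrightarrow> y \<in> W" and W: "forest (contract A x y) (W - {y})"
  shows "forest A W"
  unfolding forest_def
proof (intro allI impI)
  fix X assume X: "X \<subseteq> W" "X \<noteq> {}"
  let ?f = "\<lambda>p. if p = y then x else p" and ?A = "contract A x y"
  have irr: "\<not> A p p" for p using assms(2) by (auto dest: irreflpD)
  then have "x \<noteq> y" using assms(3) by blast
  note sym = sympD[OF assms(1)]
  have "?f ` X \<subseteq> W - {y}" "?f ` X \<noteq> {}" using X xy \<open>x \<noteq> y\<close> by auto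
  then have "\<exists>p\<in>?f ` X. \<forall>q\<in>?f ` X. \<forall>r\<in>?f ` X. ?A p q \<longrightarrow> ?A p r \<longrightarrow> q = r"
    using W unfolding forest_def by (elim allE[of _ "?f ` X"]) simp
  then obtain p where p: "p \<in> ?f ` X"
    and uniq_nbr: "\<forall>q\<in>?f ` X. \<forall>r\<in>?f ` X. ?A p q \<longrightarrow> ?A p r \<longrightarrow> q = r" by (elim bexE)
  have uniq: "?f q = ?f r" if "q \<in> X" "r \<in> X" "?A p (?f q)" "?A p (?f r)" for q r
    using that by (intro uniq_nbr[rule_format] imageI)
  show "\<exists>p\<in>X. \<forall>q\<in>X. \<forall>r\<in>X. A p q \<longrightarrow> A p r \<longrightarrow> q = r"
  proof (rule ccontr)
    assume "\<not> ?thesis"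
    then have two: "\<exists>q\<in>X. \<exists>r\<in>X. A p q \<and> A p r \<and> q \<noteq> r" if "p \<in> X" for p
      using that by blast
    show False
    proof (cases "p = x")
      case False
      then have "p \<in> X" "p \<noteq> y" using p \<open>x \<noteq> y\<close> by (auto split: if_splits)
      then obtain q r where qr: "q \<in> X" "r \<in> X" "A p q" "A p r" "q \<noteq> r" using two by blast
      have "?A p (?f q)" "?A p (?f r)" using qr irr False \<open>p \<noteq> y\<close> unfolding contract_def by auto
      then have "?f q = ?f r" using uniq qr(1,2) by blast
      then have "A p x \<and> A p y" using qr by (auto split: if_splits)
      then show False using free \<open>p \<in> X\<close> X by blast
    next
      case px: True
      \<comment> \<open>Apart from each other, \<open>x\<close> and \<open>y\<close> together have
        at most one neighbour in \<open>X\<close>.\<close>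
      have uniq': "q = r" if "q \<in> X" "A x q \<or> A y q" "q \<noteq> x" "q \<noteq> y"
         "r \<in> X" "A x r \<or> A y r" "r \<noteq> x" "r \<noteq> y" for q r
        using uniq[of q r] that px unfolding contract_def by auto
      show False
      proof (cases "x \<in> X \<and> y \<in> X")
        case True
        obtain q where q: "q \<in> X" "A x q" "q \<noteq> y" using two[of x] True by blast
        obtain r where r: "r \<in> X" "A y r" "r \<noteq> x" using two[of y] True by blast
        have "q \<noteq> x" "r \<noteq> y" using q r irr by auto
        then have "q = r" using uniq' q r by blast
        then show False using q r free[of q] X sym by blast
      next
        case False
        then obtain z where z: "z \<in> X" "z = x \<or> z = y" using p px by (auto split: if_splits)
        obtain q r where qr: "q \<in> X" "r \<in> X" "A z q" "A z r" "q \<noteq> r" using two[OF z(1)] by blast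
        have "q \<noteq> x" "q \<noteq> y" "r \<noteq> x" "r \<noteq> y" using qr irr z False by auto
        then show False using uniq'[of q r] qr z by blast
      qed
    qed
  qed
qed

lemma accompaniedI:
  assumes "w \<in> V" "w \<noteq> u" "w \<noteq> v" "A u w \<or> A v w" "c u = c v \<or> c w = c u \<or> c w = c v"
  shows "accompanied V A c u v"
  using assms unfolding accompanied_def by blast

lemma accompaniedE:
  assumes "accompanied V A c u v"
  obtains w where "w \<in> V" "w \<noteq> u" "w \<noteq> v" "A u w \<or> A v w" "c u = c v \<or> c w = c u \<or> c w = c v"
  using assms unfolding accompanied_def by blast

lemma good_colouringD:
  assumes "good_colouring V A c"
  shows "v \<in> V \<Longrightarrow> c v < 3" and "m < 3 \<Longrightarrow> forest A {v\<in>V. c v \<noteq> m}"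
    and "u \<in> V \<Longrightarrow> v \<in> V \<Longrightarrow> A u v \<Longrightarrow> distinguished V A u v \<Longrightarrow> accompanied V A c u v"
  using assms unfolding good_colouring_def by auto

text \<open>Here \<open>z\<close> stands for the part of the graph outside \<open>S\<close>, which is attached to \<open>S\<close>
  by the two edges \<open>aa'\<close> and \<open>bb'\<close> only.\<close>

locale attached_part =
  fixes V S :: "'a set" and A A' :: "'a \<Rightarrow> 'a \<Rightarrow> bool" and a b a' b' z :: 'a and c c1 :: "'a \<Rightarrow> nat"
  assumes A: "symp A" "irreflp A" "symp A'" and S: "S \<subseteq> V" "a \<in> S" "b \<in> S" "a \<noteq> b"
    and out: "a' \<in> V - S" "b' \<in> V - S" "A a a'" "A b b'"
    and cross: "\<And>p q. p \<in> S \<Longrightarrow> q \<in> V - S \<Longrightarrow> A p q \<Longrightarrow> p = a \<and> q = a' \<or> p = b \<and> q = b'"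
    and z: "z \<notin> S" "\<And>p. p \<in> S \<Longrightarrow> A' z p \<longleftrightarrow> p = a \<or> p = b"
    and A': "\<And>p q. p \<in> S \<Longrightarrow> q \<in> S \<Longrightarrow> A' p q \<longleftrightarrow> A p q"
    and good: "good_colouring (insert z S) A' c1"
    and c: "\<And>p. p \<in> S \<Longrightarrow> c p = c1 p" "c a' = c a" "c b' = c1 z"
    and c1: "c1 a \<noteq> c1 b" "c1 a \<noteq> c1 z" "c1 b \<noteq> c1 z"
begin

lemma z': "p \<in> S \<Longrightarrow> A' p z \<longleftrightarrow> p = a \<or> p = b"
  using z(2) A(3) by (metis sympD)

text \<open>Both ends of \<open>aa'\<close> have the same colour, so \<open>a'\<close> is a witness
  for every edge at \<open>a\<close>. Any other edge is distinguished in the graph with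
  \<open>z\<close> as well, and a witness \<open>z\<close> found there is replaced by
  \<open>b'\<close>, which has the same colour.\<close>

lemma accompanied_inside:
  assumes pq: "p \<in> S" "q \<in> S" "A p q" "distinguished V A p q"
  shows "accompanied V A c p q"
proof (cases "p = a \<or> q = a")
  case True
  then show ?thesis using out pq S c by (intro accompaniedI[of a']) auto
next
  case False
  have "\<exists>w\<in>insert z S. w \<noteq> p \<and> w \<noteq> q \<and> A' p w \<noteq> A' q w"
  proof (cases "p = b \<or> q = b")
    case True
    have "p \<noteq> q" using pq A(2) by (auto dest: irreflpD)
    \<comment> \<open>The other end of the edge is not \<open>a\<close>, so \<open>z\<close> is
      adjacent to \<open>b\<close> only.\<close>
    then have "z \<noteq> p" "z \<noteq> q" "A' p z \<noteq> A' q z" using True False pq z(1) z' by auto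
    then show ?thesis by blast
  next
    case False': False
    obtain w where w: "w \<in> V" "w \<noteq> p" "w \<noteq> q" "A p w \<noteq> A q w"
      using pq(4) by (auto simp: distinguished_def)
    then have "w \<in> S" using cross pq False False' by blast
    then show ?thesis using w A' pq by blast
  qed
  then have "accompanied (insert z S) A' c1 p q"
    using good_colouringD(3)[OF good, of p q] pq A' by (auto simp: distinguished_def)
  then obtain w where w: "w \<in> insert z S" "w \<noteq> p" "w \<noteq> q" "A' p w \<or> A' q w"
    "c1 p = c1 q \<or> c1 w = c1 p \<or> c1 w = c1 q" by (rule accompaniedE)
  show ?thesis
  proof (cases "w = z")
    case True
    then have "p = b \<or> q = b" using w(4) z' pq False by blast
    then show ?thesis using True w out pq c by (intro accompaniedI[of b']) auto
  next
    case False
    then show ?thesis using w S pq c A' by (intro accompaniedI[of w]) auto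
  qed
qed

text \<open>\<open>f\<close> distinguishes the edge \<open>bz\<close>, which therefore has a
  witness. It is not \<open>a\<close>, because \<open>a\<close>, \<open>b\<close>, \<open>z\<close>
  have three colours; so it lies in \<open>S\<close> and serves for \<open>bb'\<close> too.\<close>

lemma accompanied_outward:
  assumes f: "f \<in> S" "f \<noteq> a" "A b f"
  shows "accompanied V A c b b'"
proof -
  have "f \<noteq> b" using f A(2) by (auto dest: irreflpD)
  then have "distinguished (insert z S) A' b z"
    unfolding distinguished_def using f z A' S by (intro bexI[of _ f]) auto
  then have "accompanied (insert z S) A' c1 b z"
    using good_colouringD(3)[OF good, of b z] S z' by simp
  then obtain w where w: "w \<in> insert z S" "w \<noteq> b" "w \<noteq> z" "A' b w \<or> A' z w"
    "c1 b = c1 z \<or> c1 w = c1 b \<or> c1 w = c1 z" by (rule accompaniedE)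
  then have "w \<noteq> a" "w \<in> S" using c1 by auto
  then have "A b w" using w z A' S by blast
  then show ?thesis using w \<open>w \<in> S\<close> S out c by (intro accompaniedI[of w]) auto
qed

end

section \<open>Gluing colourings along a 4-cycle\<close>

definition add_edge :: "('a \<Rightarrow> 'a \<Rightarrow> bool) \<Rightarrow> 'a \<Rightarrow> 'a \<Rightarrow> 'a \<Rightarrow> 'a \<Rightarrow> bool" where
  "add_edge A a b p q \<longleftrightarrow> A p q \<or> p = a \<and> q = b \<or> p = b \<and> q = a"

lemma symp_add_edge: "symp A \<Longrightarrow> symp (add_edge A a b)"
  unfolding symp_def add_edge_def by blast

lemma irreflp_add_edge: "irreflp A \<Longrightarrow> a \<noteq> b \<Longrightarrow> irreflp (add_edge A a b)"
  unfolding irreflp_def add_edge_def by blast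

text \<open>The chord \<open>xv\<close> turns the 4-cycle \<open>u\<close>, \<open>x\<close>,
  \<open>y\<close>, \<open>v\<close> into two triangles. In the graph on \<open>R\<close> the vertex
  \<open>x\<close> represents \<open>C\<close>, and in the graph on \<open>C\<close> the vertex
  \<open>v\<close> represents \<open>R\<close>. Both colourings are normalised on the triangle that
  contains the representative.\<close>

lemma good_colouring_glue:
  assumes fin: "finite C" "finite R" and disj: "C \<inter> R = {}" and A: "symp A" "irreflp A"
    and uv: "u \<in> R" "v \<in> R" "u \<noteq> v" "A u v" and xy: "x \<in> C" "y \<in> C" "x \<noteq> y" "A x y"
    and ux: "A u x" and vy: "A v y"
    and cross: "\<And>p q. p \<in> R \<Longrightarrow> q \<in> C \<Longrightarrow> A p q \<Longrightarrow> p = u \<and> q = x \<or> p = v \<and> q = y"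
    and R: "\<exists>c. good_colouring (insert x R) (add_edge A x v) c"
    and C: "\<exists>c. good_colouring (insert v C) (add_edge A x v) c"
    and extra: "(\<exists>f\<in>R. f \<noteq> u \<and> A v f) \<or> (\<exists>f\<in>C. f \<noteq> x \<and> A y f)"
  shows "\<exists>c. good_colouring (C \<union> R) A c"
proof -
  let ?A = "add_edge A x v"
  have ne: "x \<noteq> v" "x \<noteq> u" "y \<noteq> u" "y \<noteq> v" and mem: "x \<notin> R" "y \<notin> R" "u \<notin> C" "v \<notin> C"
    using disj uv xy by auto
  note sym = sympD[OF A(1)]
  have A': "symp ?A" "irreflp ?A" using symp_add_edge irreflp_add_edge A ne by metis+
  have AR: "?A p q \<longleftrightarrow> A p q" if "p \<in> R" "q \<in> R" for p q using that mem by (auto simp: add_edge_def)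
  have AC: "?A p q \<longleftrightarrow> A p q" if "p \<in> C" "q \<in> C" for p q using that mem by (auto simp: add_edge_def)
  have Ax: "?A x p \<longleftrightarrow> p = u \<or> p = v" if "p \<in> R" for p
    using that cross[of p x] sym ux xy ne by (auto simp: add_edge_def)
  have Av: "?A v p \<longleftrightarrow> p = x \<or> p = y" if "p \<in> C" for p
    using that cross[of v p] vy uv ne by (auto simp: add_edge_def)
  obtain c1 where c1: "good_colouring (insert x R) ?A c1" "c1 u = 0" "c1 v = 1" "c1 x = 2"
  proof -
    obtain c where "good_colouring (insert x R) ?A c" using R by blast
    then show ?thesis
    proof (rule good_colouring_normalise[OF _ A'])
      show "?A u v" "?A v x" "?A u x" using uv ux by (auto simp: add_edge_def)
    qed (use uv that in auto)
  qed
  obtain c2 where c2: "good_colouring (insert v C) ?A c2" "c2 x = 0" "c2 v = 1" "c2 y = 2"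
  proof -
    obtain c where "good_colouring (insert v C) ?A c" using C by blast
    then show ?thesis
    proof (rule good_colouring_normalise[OF _ A'])
      show "?A x v" "?A v y" "?A x y" using xy vy by (auto simp: add_edge_def)
    qed (use xy that in auto)
  qed
  \<comment> \<open>Each side keeps its own colours, so \<open>u\<close> and \<open>x\<close> agree,
    \<open>y\<close> has the colour of \<open>x\<close> in \<open>c1\<close>, and \<open>v\<close>
    has its colour in \<open>c2\<close>. This is what the locale asks for on both sides.\<close>
  define c where "c = (\<lambda>p. if p \<in> R then c1 p else c2 p)"
  have cR: "c p = c1 p" if "p \<in> R" for p using that by (simp add: c_def)
  have cC: "c p = c2 p" if "p \<in> C" for p using that disj by (auto simp: c_def)
  have cvals: "c u = 0" "c v = 1" "c x = 0" "c y = 2" using cR cC uv xy c1 c2 by auto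
  interpret R: attached_part "C \<union> R" R A ?A u v x y x c c1
    using A A' uv xy ux vy mem cross disj Ax AR c1 cvals cR by unfold_locales auto
  interpret C: attached_part "C \<union> R" C A ?A x y u v v c c2
    using A A' uv xy ux vy mem cross disj Av AC c2 cvals cC sym by unfold_locales (auto, (metis sym)+)
  have "good_colouring (C \<union> R) A c"
    unfolding good_colouring_def
  proof (intro conjI ballI allI impI)
    fix p assume "p \<in> C \<union> R"
    then show "c p < 3" using good_colouringD(1) c1(1) c2(1) cR cC by (metis Un_iff insertCI)
  next
    fix m :: nat assume m: "m < 3"
    let ?R = "{p\<in>R. c p \<noteq> m}" and ?C = "{p\<in>C. c p \<noteq> m}"
    have 1: "forest A ?R"
      using cR by (intro forest_mono[OF good_colouringD(2)[OF c1(1) m]]) (auto simp: add_edge_def)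
    have 2: "forest A ?C"
      using cC by (intro forest_mono[OF good_colouringD(2)[OF c2(1) m]]) (auto simp: add_edge_def)
    \<comment> \<open>Deleting colour 0 destroys \<open>ux\<close>, and deleting 1 or 2 destroys
      \<open>vy\<close>, so at most one edge joins the two forests.\<close>
    have "forest A (?R \<union> ?C)"
    proof (rule forest_bridge[OF 1 2 _ _ A, of "if m = 0 then v else u" "if m = 0 then y else x"])
      fix p q assume pq: "p \<in> ?R" "q \<in> ?C" "A p q"
      then have "p = u \<and> q = x \<or> p = v \<and> q = y" using cross by blast
      then show "p = (if m = 0 then v else u) \<and> q = (if m = 0 then y else x)"
        using pq cvals m by (auto simp: less_Suc_eq numeral_3_eq_3)
    qed (use fin in auto)
    moreover have "?R \<union> ?C = {p\<in>C \<union> R. c p \<noteq> m}" by blast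
    ultimately show "forest A {p\<in>C \<union> R. c p \<noteq> m}" by simp
  next
    \<comment> \<open>By \<open>extra\<close>, one of the two sides supplies the neighbour
      \<open>f\<close>.\<close>
    have vy: "accompanied (C \<union> R) A c v y"
      using extra R.accompanied_outward C.accompanied_outward accompanied_commute by metis
    have ux: "accompanied (C \<union> R) A c u x"
      using xy ne cvals by (intro accompaniedI[of y]) auto
    have cross': "accompanied (C \<union> R) A c p q" if "p \<in> R" "q \<in> C" "A p q" for p q
      using cross[OF that] ux vy by blast
    fix p q assume pq: "p \<in> C \<union> R" "q \<in> C \<union> R" "A p q" "distinguished (C \<union> R) A p q"
    then consider "p \<in> R" "q \<in> R" | "p \<in> C" "q \<in> C" | "p \<in> R" "q \<in> C" | "p \<in> C" "q \<in> R" by blast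
    then show "accompanied (C \<union> R) A c p q"
    proof cases
      case 1
      then show ?thesis using pq R.accompanied_inside by blast
    next
      case 2
      then show ?thesis using pq C.accompanied_inside by blast
    next
      case 3
      then show ?thesis using pq cross' by blast
    next
      case 4
      then show ?thesis using pq cross'[of q p] sym accompanied_commute by metis
    qed
  qed
  then show ?thesis by blast
qed

text \<open>Opposite vertices \<open>u\<close> and \<open>y\<close> get colour 0, while
  \<open>v\<close> and \<open>x\<close> get 1 and 2. All three colours occur, so deleting any class
  breaks the cycle, and the two edges at \<open>v\<close>, as well as those at \<open>x\<close>,
  accompany each other.\<close>

lemma good_colouring_C4_component:
  assumes V: "u \<in> V" "v \<in> V" "x \<in> V" "y \<in> V" "u \<noteq> y" "v \<noteq> x" and A: "symp A" "irreflp A"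
    and nbrs: "\<And>p. p \<in> V \<Longrightarrow> A u p \<longleftrightarrow> p = v \<or> p = x" "\<And>p. p \<in> V \<Longrightarrow> A y p \<longleftrightarrow> p = v \<or> p = x"
      "\<And>p. p \<in> V \<Longrightarrow> A v p \<longleftrightarrow> p = u \<or> p = y" "\<And>p. p \<in> V \<Longrightarrow> A x p \<longleftrightarrow> p = u \<or> p = y"
    and good: "\<exists>c. good_colouring (V - {u, v, x, y}) A c"
  shows "\<exists>c. good_colouring V A c"
proof -
  let ?W = "V - {u, v, x, y}"
  obtain c where c: "good_colouring ?W A c" using good by blast
  have ne: "u \<noteq> v" "u \<noteq> x" "y \<noteq> v" "y \<noteq> x" using nbrs V A(2) by (metis irreflpD)+
  define d where "d = c(u := 0, y := 0, v := 1, x := 2)"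
  have d: "d u = 0" "d y = 0" "d v = 1" "d x = 2" "\<And>p. p \<in> ?W \<Longrightarrow> d p = c p"
    using ne V by (auto simp: d_def)
  have closed: "A p q \<Longrightarrow> q \<in> ?W" if "p \<in> ?W" "q \<in> V" for p q
    using that nbrs sympD[OF A(1)] by (metis DiffE DiffI insertCI insertE singletonD)
  have "good_colouring V A d"
    unfolding good_colouring_def
  proof (intro conjI ballI allI impI)
    fix p assume "p \<in> V"
    then show "d p < 3" using d good_colouringD(1)[OF c, of p] by (cases "p \<in> ?W") auto
  next
    fix m :: nat assume m: "m < 3"
    show "forest A {p\<in>V. d p \<noteq> m}"
      unfolding forest_def
    proof (intro allI impI)
      fix X assume X: "X \<subseteq> {p\<in>V. d p \<noteq> m}" "X \<noteq> {}"
      show "\<exists>p\<in>X. \<forall>q\<in>X. \<forall>r\<in>X. A p q \<longrightarrow> A p r \<longrightarrow> q = r"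
      proof (cases "X \<inter> {u, v, x, y} = {}")
        case True
        then have "X \<subseteq> {p\<in>?W. c p \<noteq> m}" using X d(5) by auto
        then show ?thesis using good_colouringD(2)[OF c m] X(2) unfolding forest_def by simp
      next
        case False
        have "\<not> {u, v, x, y} \<subseteq> X" using X d m by (auto simp: less_Suc_eq numeral_3_eq_3)
        then have "(u \<in> X \<or> y \<in> X) \<and> \<not> (v \<in> X \<and> x \<in> X) \<or> (v \<in> X \<or> x \<in> X) \<and> \<not> (u \<in> X \<and> y \<in> X)"
          using False by blast
        moreover have leaf: ?thesis
          if "z \<in> X" "\<And>p. p \<in> V \<Longrightarrow> A z p \<longleftrightarrow> p = s \<or> p = t" "\<not> (s \<in> X \<and> t \<in> X)" for z s t
        proof -
          have "q = r" if "q \<in> X" "r \<in> X" "A z q" "A z r" for q r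
            using that \<open>\<not> (s \<in> X \<and> t \<in> X)\<close> \<open>\<And>p. p \<in> V \<Longrightarrow> A z p \<longleftrightarrow> p = s \<or> p = t\<close> X(1) by blast
          then show ?thesis using \<open>z \<in> X\<close> by blast
        qed
        ultimately consider "u \<in> X \<and> \<not> (v \<in> X \<and> x \<in> X)" | "y \<in> X \<and> \<not> (v \<in> X \<and> x \<in> X)"
          | "v \<in> X \<and> \<not> (u \<in> X \<and> y \<in> X)" | "x \<in> X \<and> \<not> (u \<in> X \<and> y \<in> X)" by argo
        then show ?thesis 
        proof cases
          case 1
          then show ?thesis using leaf[OF _ nbrs(1)] by blast
        next
          case 2
          then show ?thesis using leaf[OF _ nbrs(2)] by blast
        next
          case 3
          then show ?thesis using leaf[OF _ nbrs(3)] by blast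
        next
          case 4
          then show ?thesis using leaf[OF _ nbrs(4)] by blast
        qed
      qed
    qed
  next
    fix p q assume pq: "p \<in> V" "q \<in> V" "A p q" "distinguished V A p q"
    show "accompanied V A d p q"
    proof (cases "p \<in> ?W")
      case True
      then have "q \<in> ?W" using closed pq by blast
      obtain w where w: "w \<in> V" "w \<noteq> p" "w \<noteq> q" "A p w \<noteq> A q w"
        using pq(4) by (auto simp: distinguished_def)
      then have "w \<in> ?W" using closed True \<open>q \<in> ?W\<close> by blast
      then have "accompanied ?W A c p q"
        using w pq True \<open>q \<in> ?W\<close> good_colouringD(3)[OF c, of p q] unfolding distinguished_def by blast
      then obtain w where "w \<in> ?W" "w \<noteq> p" "w \<noteq> q" "A p w \<or> A q w"
        "c p = c q \<or> c w = c p \<or> c w = c q" by (rule accompaniedE)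
      then show ?thesis using d(5) True \<open>q \<in> ?W\<close> by (intro accompaniedI[of w]) auto
    next
      case False
      have u: "accompanied V A d u p" "accompanied V A d y p" if "p = v \<or> p = x" for p
        using that d V ne nbrs by (auto intro: accompaniedI[of y] accompaniedI[of u])
      have "p = u \<or> p = y \<or> p = v \<or> p = x" using False pq by blast
      then show ?thesis using u nbrs pq accompanied_commute by metis
    qed
  qed
  then show ?thesis by blast
qed

text \<open>The new vertex is put last; its neighbours are among the ends of an edge, which form a
  clique.\<close>

lemma elim_width_attach:
  assumes "elim_width 2 V A" "S \<subseteq> V" "z \<notin> S" "a \<in> S" "b \<in> S" "A a b" "A b a"
    and "\<And>p q. p \<in> S \<Longrightarrow> q \<in> S \<Longrightarrow> p \<noteq> q \<Longrightarrow> A' p q \<Longrightarrow> A p q"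
    and "\<And>p. p \<in> S \<Longrightarrow> A' z p \<or> A' p z \<Longrightarrow> p = a \<or> p = b"
  shows "elim_width 2 (insert z S) A'"
proof (rule elim_width.insert[of 2 S A z "{a, b}"])
  show "elim_width 2 S A" using assms(1,2) by (rule elim_width_mono)
  show "card {a, b} \<le> 2" by (simp add: card_insert_if)
qed (use assms in auto)

text \<open>If \<open>v\<close> or \<open>y\<close> has a further neighbour on its own side, the
  sides are glued directly; if \<open>u\<close> or \<open>x\<close> has one, the roles of
  \<open>ux\<close> and \<open>vy\<close> are exchanged. Otherwise the 4-cycle is a whole
  component.\<close>

lemma good_colouring_C4:
  fixes V :: "'a set"
  assumes IH: "\<And>(V' :: 'a set) A'. card V' < card V \<Longrightarrow> elim_width 2 V' A' \<Longrightarrow> finite V' \<Longrightarrow> symp A' \<Longrightarrow>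
      irreflp A' \<Longrightarrow> \<exists>c. good_colouring V' A' c"
    and V: "elim_width 2 V A" "finite V" and A: "symp A" "irreflp A"
    and uv: "u \<in> V" "v \<in> V" "A u v" and xy: "x \<in> V" "y \<in> V" "A x y"
    and disj: "u \<notin> {x, y}" "v \<notin> {x, y}" and ux: "A u x" "\<not> A u y" and vy: "A v y" "\<not> A v x"
    and twins: "\<And>w. w \<in> V \<Longrightarrow> w \<notin> {u, v, x, y} \<Longrightarrow> A u w \<longleftrightarrow> A v w"
  shows "\<exists>c. good_colouring V A c"
proof -
  have irr: "\<not> A p p" for p using A(2) by (auto dest: irreflpD)
  note sym = sympD[OF A(1)]
  have ne: "u \<noteq> v" "x \<noteq> y" "u \<noteq> x" "u \<noteq> y" "v \<noteq> x" "v \<noteq> y"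
    using irr uv(3) xy(3) disj by auto
  let ?U = "V - {u, v}"
  let ?D = "{(a, b). a \<in> ?U \<and> b \<in> ?U \<and> A a b}"
  define C where "C = {p. (x, p) \<in> ?D\<^sup>*}"
  define R where "R = V - C"
  have CU: "C \<subseteq> ?U"
  proof
    fix p assume "p \<in> C"
    then have "(x, p) \<in> ?D\<^sup>*" by (simp add: C_def)
    then show "p \<in> ?U" by (rule rtranclE) (use xy ne in auto)
  qed
  have xC: "x \<in> C" by (simp add: C_def)
  have "(x, y) \<in> ?D" using xy ne by auto
  then have yC: "y \<in> C" by (auto simp: C_def)
  have uR: "u \<in> R" and vR: "v \<in> R" using CU uv by (auto simp: R_def)
  have VCR: "V = C \<union> R" "C \<inter> R = {}" using CU by (auto simp: R_def)
  have fin: "finite C" "finite R" using V(2) VCR by auto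
  \<comment> \<open>Contracting \<open>xy\<close> makes \<open>x\<close> a common neighbour of
    \<open>u\<close> and \<open>v\<close>. A second one, \<open>q\<close>, would have to be
    separated from \<open>x\<close> by removing \<open>u\<close> and \<open>v\<close>, but both lie
    in \<open>C\<close>.\<close>
  have not_common: "\<not> (A u q \<and> A v q)" if q: "q \<in> C" "q \<noteq> x" "q \<noteq> y" for q
  proof
    assume uvq: "A u q \<and> A v q"
    let ?K = "contract A x y" and ?V = "V - {y}"
    have "(x, q) \<in> ?D\<^sup>*" using q by (simp add: C_def)
    then have "((if x = y then x else x), (if q = y then x else q)) \<in>
        {(a, b). a \<in> ?U - {y} \<and> b \<in> ?U - {y} \<and> ?K a b}\<^sup>*"
      using xy ne by (intro rtrancl_contract) auto
    moreover have "?U - {y} = ?V - {u, v}" by blast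
    ultimately have "(x, q) \<in> {(a, b). a \<in> ?V - {u, v} \<and> b \<in> ?V - {u, v} \<and> ?K a b}\<^sup>*"
      using q by simp
    moreover have "(x, q) \<notin> {(a, b). a \<in> ?V - {u, v} \<and> b \<in> ?V - {u, v} \<and> ?K a b}\<^sup>*"
    proof (rule common_neighbours_separated)
      show "elim_width 2 ?V ?K" using elim_width_contract[OF V(1)] xy ne sym by blast
      show "symp ?K" using A(1) by (rule symp_contract)
      show "irreflp ?K" by (rule irreflp_contract)
      show "?K u x" "?K v x" "?K u v" "?K u q" "?K v q"
        using ux vy uv uvq ne irr unfolding contract_def by auto
      show "x \<noteq> q" "q \<in> ?V - {u, v}" using q CU by auto
    qed (use V uv xy ne in auto)
    ultimately show False by blast
  qed
  have cross: "p = u \<and> q = x \<or> p = v \<and> q = y" if pq: "p \<in> R" "q \<in> C" "A p q" for p q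
  proof -
    have qV: "q \<in> V" "q \<noteq> u" "q \<noteq> v" using pq CU by auto
    have "p \<in> {u, v}"
    proof (rule ccontr)
      assume "p \<notin> {u, v}"
      then have "(q, p) \<in> ?D" using pq qV sym by (auto simp: R_def)
      then have "p \<in> C" using pq(2) unfolding C_def by (auto intro: rtrancl_into_rtrancl)
      then show False using pq(1) by (simp add: R_def)
    qed
    then show ?thesis using not_common[OF pq(2)] twins[OF qV(1)] qV pq(3) ux vy by auto
  qed
  \<comment> \<open>Each side has at least two vertices, so the other side with one vertex added is
    still smaller than \<open>V\<close>.\<close>
  have sizes: "card (insert p R) < card V" "card (insert q C) < card V" for p q
  proof -
    have "card V = card C + card R" using VCR fin by (metis card_Un_disjoint)
    moreover have "card {x, y} \<le> card C" "card {u, v} \<le> card R"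
      using fin xC yC uR vR by (auto intro: card_mono)
    moreover have "card (insert p R) \<le> Suc (card R)" "card (insert q C) \<le> Suc (card C)"
      by (simp_all add: card_insert_le_m1 card_insert_if fin)
    ultimately show "card (insert p R) < card V" "card (insert q C) < card V" using ne by auto
  qed
  \<comment> \<open>The vertices are bound anew so that the fact also serves with the two crossing
    edges exchanged.\<close>
  have side: "\<exists>c. good_colouring (insert x R) (add_edge A x v) c"
      "\<exists>c. good_colouring (insert v C) (add_edge A x v) c"
    if xC: "x \<in> C" and vR: "v \<in> R" and uR: "u \<in> R" and yC: "y \<in> C" and "A u v" "A x y"
      and cross: "\<And>p q. p \<in> R \<Longrightarrow> q \<in> C \<Longrightarrow> A p q \<Longrightarrow> p = u \<and> q = x \<or> p = v \<and> q = y"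
    for u v x y
  proof -
    have "x \<notin> R" "v \<notin> C" "x \<noteq> v" using VCR xC vR by auto
    then have A': "symp (add_edge A x v)" "irreflp (add_edge A x v)"
      using A symp_add_edge irreflp_add_edge by metis+
    have "elim_width 2 (insert x R) (add_edge A x v)"
    proof (rule elim_width_attach[OF V(1)])
      show "p = u \<or> p = v" if "p \<in> R" "add_edge A x v x p \<or> add_edge A x v p x" for p
        using that cross[of p x] xC sym by (auto simp: add_edge_def)
    qed (use that VCR sym \<open>x \<notin> R\<close> in \<open>auto simp: add_edge_def\<close>)
    then show "\<exists>c. good_colouring (insert x R) (add_edge A x v) c"
      using fin by (intro IH sizes A') simp_all
    have "elim_width 2 (insert v C) (add_edge A x v)"
    proof (rule elim_width_attach[OF V(1)])
      show "p = x \<or> p = y" if "p \<in> C" "add_edge A x v v p \<or> add_edge A x v p v" for p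
        using that cross[of v p] vR sym by (auto simp: add_edge_def)
    qed (use that VCR sym \<open>v \<notin> C\<close> in \<open>auto simp: add_edge_def\<close>)
    then show "\<exists>c. good_colouring (insert v C) (add_edge A x v) c"
      using fin by (intro IH sizes A') simp_all
  qed
  consider "(\<exists>f\<in>R. f \<noteq> u \<and> A v f) \<or> (\<exists>f\<in>C. f \<noteq> x \<and> A y f)"
    | "(\<exists>f\<in>R. f \<noteq> v \<and> A u f) \<or> (\<exists>f\<in>C. f \<noteq> y \<and> A x f)"
    | "\<And>f. f \<in> R \<Longrightarrow> A v f \<Longrightarrow> f = u" "\<And>f. f \<in> R \<Longrightarrow> A u f \<Longrightarrow> f = v"
      "\<And>f. f \<in> C \<Longrightarrow> A y f \<Longrightarrow> f = x" "\<And>f. f \<in> C \<Longrightarrow> A x f \<Longrightarrow> f = y" by blast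
  then show ?thesis
  proof cases
    case 1
    show ?thesis unfolding VCR(1)
      by (rule good_colouring_glue[OF fin VCR(2) A uR vR ne(1) uv(3) xC yC ne(2) xy(3) ux(1) vy(1) cross
          side[OF xC vR uR yC uv(3) xy(3) cross] 1])
  next
    case 2
    have cross': "p = v \<and> q = y \<or> p = u \<and> q = x" if "p \<in> R" "q \<in> C" "A p q" for p q
      using cross[OF that] by blast
    show ?thesis unfolding VCR(1)
      by (rule good_colouring_glue[OF fin VCR(2) A vR uR ne(1)[symmetric] sym[OF uv(3)] yC xC
          ne(2)[symmetric] sym[OF xy(3)] vy(1) ux(1) cross'
          side[OF yC uR vR xC sym[OF uv(3)] sym[OF xy(3)] cross'] 2])
  next
    case 3
    show ?thesis
    proof (rule good_colouring_C4_component[of u V v x y])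
      fix p assume "p \<in> V"
      then have p: "p \<in> C \<or> p \<in> R" using VCR by blast
      show "A u p \<longleftrightarrow> p = v \<or> p = x" using p 3(2) cross[of u p] uR uv ux ne by blast
      show "A v p \<longleftrightarrow> p = u \<or> p = y" using p 3(1) cross[of v p] vR uv vy ne sym by blast
      show "A y p \<longleftrightarrow> p = v \<or> p = x" using p 3(3) cross[of p y] yC xy vy ne sym by blast
      show "A x p \<longleftrightarrow> p = u \<or> p = y" using p 3(4) cross[of p x] xC xy ux ne sym by blast
    next
      have "card (V - {u, v, x, y}) < card V"
        using V(2) uv by (intro psubset_card_mono) auto
      moreover have "elim_width 2 (V - {u, v, x, y}) A" using V(1) by (rule elim_width_mono) auto
      ultimately show "\<exists>c. good_colouring (V - {u, v, x, y}) A c"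
        using V(2) by (intro IH A) simp_all
    qed (use uv xy ne A in auto)
  qed
qed

section \<open>Existence of good colourings in width two\<close>

theorem good_colouring_exists:
  assumes "elim_width 2 V A" "finite V" "symp A" "irreflp A"
  shows "\<exists>c. good_colouring V A c"
  using assms
proof (induction "card V" arbitrary: V A rule: less_induct)
  case less
  note A = less.prems(3,4) and V = less.prems(1,2)
  note sym = sympD[OF A(1)]
  have irr: "\<not> A p p" for p using A(2) by (auto dest: irreflpD)
  show ?case
  proof (cases "\<forall>p\<in>V. \<forall>q\<in>V. A p q \<longrightarrow> (\<exists>r\<in>V. A p r \<and> A q r)")
    case True
    then show ?thesis using good_colouring_triangulated[OF V(1) A] by blast
  next
    case False
    then obtain x y where xy: "x \<in> V" "y \<in> V" "A x y" and free: "\<And>r. r \<in> V \<Longrightarrow> \<not> (A r x \<and> A r y)"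
      using sym by blast
    have "x \<noteq> y" using irr xy by blast
    let ?K = "contract A x y" and ?W = "V - {y}"
    have "elim_width 2 ?W ?K" using elim_width_contract[OF V(1)] xy \<open>x \<noteq> y\<close> sym by blast
    moreover have "card ?W < card V" using xy V by (intro card_Diff1_less)
    moreover have "finite ?W" using V by blast
    ultimately have "\<exists>c. good_colouring ?W ?K c"
      by (intro less.hyps symp_contract irreflp_contract A)
    then obtain c where c: "good_colouring ?W ?K c" by blast
    define d where "d = c(y := c x)"
    have d: "d x = c x" "d y = c x" "\<And>p. p \<noteq> y \<Longrightarrow> d p = c p" using \<open>x \<noteq> y\<close> by (auto simp: d_def)
    show ?thesis
    proof (cases "good_colouring V A d")
      case True
      then show ?thesis by blast
    next
      case False
      have "d p < 3" if "p \<in> V" for p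
        using that d good_colouringD(1)[OF c] xy \<open>x \<noteq> y\<close> by (cases "p = y") auto
      moreover have "forest A {p\<in>V. d p \<noteq> m}" if "m < 3" for m
      proof (rule forest_contract[OF A xy(3)])
        have "{p\<in>V. d p \<noteq> m} - {y} = {p\<in>?W. c p \<noteq> m}" using d by auto
        then show "forest ?K ({p\<in>V. d p \<noteq> m} - {y})" using good_colouringD(2)[OF c that] by simp
      qed (use free xy d in auto)
      ultimately obtain u v where uv: "u \<in> V" "v \<in> V" "A u v" "distinguished V A u v"
        and nacc: "\<not> accompanied V A d u v"
        using False unfolding good_colouring_def by blast
      have "u \<noteq> v" using uv irr by blast
      \<comment> \<open>\<open>x\<close> and \<open>y\<close> have the same colour, so
        \<open>xy\<close> accompanies all other edges at its ends; for \<open>xy\<close> itself, any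
        witness of \<open>distinguished\<close> will do.\<close>
      have end_acc: "accompanied V A d p q" if "p \<in> {x, y}" "A p q" "distinguished V A p q" for p q
      proof (cases "q \<in> {x, y}")
        case True
        then have "d p = d q" using that d by auto
        then show ?thesis using that(3) unfolding distinguished_def accompanied_def by blast
      next
        case False
        then show ?thesis using that xy d \<open>x \<noteq> y\<close> sym
          by (intro accompaniedI[of "if p = x then y else x"]) auto
      qed
      have uvxy: "u \<notin> {x, y}" "v \<notin> {x, y}"
        using end_acc[of u v] end_acc[of v u] nacc uv sym accompanied_commute
        unfolding distinguished_def by metis+
      have K: "?K p x \<longleftrightarrow> A p x \<or> A p y" "\<And>w. w \<noteq> x \<Longrightarrow> ?K p w \<longleftrightarrow> A p w" if "p \<notin> {x, y}" for p
        using that irr unfolding contract_def by auto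
      \<comment> \<open>A witness in the contracted graph lifts: the merged vertex is replaced by
        whichever of \<open>x\<close>, \<open>y\<close> is adjacent to \<open>u\<close> or
        \<open>v\<close>, and both have its colour.\<close>
      have "\<not> accompanied ?W ?K c u v"
      proof
        assume "accompanied ?W ?K c u v"
        then obtain w where w: "w \<in> ?W" "w \<noteq> u" "w \<noteq> v" "?K u w \<or> ?K v w"
          "c u = c v \<or> c w = c u \<or> c w = c v" by (rule accompaniedE)
        obtain w' where w': "w' \<in> V" "w' \<noteq> u" "w' \<noteq> v" "d w' = c w" "A u w' \<or> A v w'"
        proof (cases "w = x")
          case True
          then consider "A u x \<or> A v x" | "A u y \<or> A v y"
            using w(4) K(1)[OF uvxy(1)] K(1)[OF uvxy(2)] by blast
          then show ?thesis
          proof cases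
            case 1
            then show ?thesis using True uvxy xy d by (intro that[of x]) auto
          next
            case 2
            then show ?thesis using True uvxy xy d by (intro that[of y]) auto
          qed
        next
          case False
          then show ?thesis using w d K(2)[OF uvxy(1)] K(2)[OF uvxy(2)] by (intro that[of w]) auto
        qed
        have "d u = c u" "d v = c v" using uvxy d by auto
        then have "accompanied V A d u v" using w(5) w' by (intro accompaniedI[of w']) auto
        then show False using nacc by blast
      qed
      then have "\<not> distinguished ?W ?K u v"
        using good_colouringD(3)[OF c, of u v] uv uvxy K(2)[OF uvxy(1)] by auto
      then have same: "?K u w \<longleftrightarrow> ?K v w" if "w \<in> V" "w \<noteq> y" "w \<noteq> u" "w \<noteq> v" for w
        using that unfolding distinguished_def by blast
      have twins: "A u w \<longleftrightarrow> A v w" if "w \<in> V" "w \<notin> {u, v, x, y}" for w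
        using same[of w] that K(2)[OF uvxy(1)] K(2)[OF uvxy(2)] by auto
      have ends: "A u x \<or> A u y \<longleftrightarrow> A v x \<or> A v y"
        using same[of x] xy(1) \<open>x \<noteq> y\<close> uvxy K(1)[OF uvxy(1)] K(1)[OF uvxy(2)] by auto
      obtain w where w: "w \<in> V" "w \<noteq> u" "w \<noteq> v" "A u w \<noteq> A v w"
        using uv(4) by (auto simp: distinguished_def)
      then have "w = x \<or> w = y" using twins by blast
      \<comment> \<open>Only \<open>x\<close> or \<open>y\<close> can distinguish \<open>u\<close>
        from \<open>v\<close>, and no vertex is adjacent to both. So \<open>u\<close> and
        \<open>v\<close> see different ends of \<open>xy\<close>.\<close>
      then have "A u x \<and> \<not> A u y \<and> A v y \<and> \<not> A v x \<or> A v x \<and> \<not> A v y \<and> A u y \<and> \<not> A u x"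
        using w ends free[OF uv(1)] free[OF uv(2)] by metis
      then show ?thesis
      proof
        assume "A u x \<and> \<not> A u y \<and> A v y \<and> \<not> A v x"
        then show ?thesis
          using good_colouring_C4[OF less.hyps V A uv(1-3) xy uvxy] twins by blast
      next
        assume "A v x \<and> \<not> A v y \<and> A u y \<and> \<not> A u x"
        then show ?thesis
          using good_colouring_C4[OF less.hyps V A uv(2,1) sym[OF uv(3)] xy uvxy(2,1)] twins by blast
      qed
    qed
  qed
qed

section \<open>From tree decompositions to elimination orderings\<close>

abbreviation edge_rel :: "'a ugraph \<Rightarrow> 'a \<Rightarrow> 'a \<Rightarrow> bool" where
  "edge_rel G \<equiv> \<lambda>p q. {p, q} \<in> edges G"

lemma symp_edge_rel: "symp (edge_rel G)"
  by (simp add: symp_def insert_commute)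

lemma irreflp_edge_rel: "simple_graph G \<Longrightarrow> irreflp (edge_rel G)"
  unfolding irreflp_def simple_graph_def by (metis doubleton_eq_iff)

lemma edge_verts: "simple_graph G \<Longrightarrow> e \<in> edges G \<Longrightarrow> e \<subseteq> verts G"
  by (auto simp: simple_graph_def)

section \<open>Walks, paths and bridges\<close>

lemma rtrancl_crossing:
  assumes "(a, b) \<in> r\<^sup>*" "a \<in> S" "b \<notin> S"
  obtains p q where "(p, q) \<in> r" "p \<in> S" "q \<notin> S"
  using assms by (induction rule: rtrancl_induct) blast+

lemma rtrancl_distinct_path:
  assumes "(a, b) \<in> r\<^sup>*"
  shows "\<exists>p. p \<noteq> [] \<and> hd p = a \<and> last p = b \<and> distinct p \<and> successively (\<lambda>x y. (x, y) \<in> r) p"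
  using assms
proof (induction rule: converse_rtrancl_induct)
  case base
  show ?case by (intro exI[of _ "[b]"]) simp
next
  case (step a a')
  then obtain p where p: "p \<noteq> []" "hd p = a'" "last p = b" "distinct p"
    "successively (\<lambda>x y. (x, y) \<in> r) p" by blast
  show ?case
  proof (cases "a \<in> set p")
    case True
    then obtain xs ys where "p = xs @ a # ys" by (meson split_list)
    then show ?thesis using p by (intro exI[of _ "a # ys"]) (auto simp: successively_append_iff)
  next
    case False
    then show ?thesis using p step.hyps(1)
      by (intro exI[of _ "a # p"]) (auto simp: successively_Cons)
  qed
qed

text \<open>Otherwise a path from \<open>l\<close> to \<open>n\<close> closes up with the edge to a
  cycle; it has at least three vertices because the edge itself was removed.\<close>

lemma acyclic_edge_is_bridge:
  assumes T: "simple_graph T" "acyclic_graph T" and ln: "{l, n} \<in> edges T"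
  shows "(l, n) \<notin> (adj T - {(l, n), (n, l)})\<^sup>*"
proof
  assume "(l, n) \<in> (adj T - {(l, n), (n, l)})\<^sup>*"
  then obtain p where p: "p \<noteq> []" "hd p = l" "last p = n" "distinct p"
    "successively (\<lambda>x y. (x, y) \<in> adj T - {(l, n), (n, l)}) p"
    using rtrancl_distinct_path by metis
  have "l \<noteq> n" using irreflp_edge_rel[OF T(1)] ln by (auto dest: irreflpD)
  have len: "3 \<le> length p"
  proof (rule ccontr)
    assume "\<not> 3 \<le> length p"
    then have "length p = 1 \<or> length p = 2" using p(1) by (cases "length p") auto
    then show False
    proof
      assume "length p = 1"
      then show False using p \<open>l \<noteq> n\<close> by (auto simp: length_Suc_conv)
    next
      assume "length p = 2"
      then show False using p by (auto simp: length_Suc_conv numeral_2_eq_2)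
    qed
  qed
  have edge: "(p ! i, p ! (Suc i mod length p)) \<in> adj T" if i: "i < length p" for i
  proof (cases "Suc i < length p")
    case True
    then show ?thesis using p(5) by (simp add: successively_conv_nth)
  next
    case False
    then have "Suc i = length p" "i = length p - 1" using i by simp_all
    then have "p ! i = n" "p ! (Suc i mod length p) = l"
      using p(1-3) by (simp_all add: last_conv_nth hd_conv_nth)
    then show ?thesis using ln by (simp add: adj_def insert_commute)
  qed
  have "p ! i \<in> verts T" if "i < length p" for i
    using edge[OF that] edge_verts[OF T(1)] by (auto simp: adj_def)
  then have "is_cycle T p"
    using p len edge by (auto simp: is_cycle_def in_set_conv_nth)
  then show False using T(2) by (auto simp: acyclic_graph_def)
qed

text \<open>Serves to append a bag \<open>S \<union> D\<close> whose old part \<open>S\<close> is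
  already a clique. The vertices of \<open>D\<close> follow one by one, each preceded by at most
  \<open>k\<close> others of the bag.\<close>

lemma elim_width_add_clique:
  assumes U: "elim_width k U B" and S: "S \<subseteq> U" "\<And>p q. p \<in> S \<Longrightarrow> q \<in> S \<Longrightarrow> p \<noteq> q \<Longrightarrow> B p q"
    and D: "finite D" "D \<inter> U = {}" "finite S" "card (S \<union> D) \<le> Suc k"
  shows "elim_width k (U \<union> D) (\<lambda>p q. p \<in> U \<and> q \<in> U \<and> B p q \<or> p \<in> S \<union> D \<and> q \<in> S \<union> D)"
  using D
proof (induction D rule: finite_induct)
  case empty
  show ?case using S by (intro elim_width_mono[OF U]) auto
next
  case (insert d D)
  have d: "d \<notin> S \<union> D" using insert S(1) by auto
  have "card (S \<union> insert d D) = Suc (card (S \<union> D))" using d insert by simp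
  then have card: "card (S \<union> D) \<le> k" using insert.prems by simp
  let ?B = "\<lambda>p q. p \<in> U \<and> q \<in> U \<and> B p q \<or> p \<in> S \<union> D \<and> q \<in> S \<union> D"
  have IH: "elim_width k (U \<union> D) ?B" using insert card by auto
  show ?case unfolding Un_insert_right
    by (rule elim_width.insert[OF IH, of _ "S \<union> D"]) (use card d insert S(1) in auto)
qed

text \<open>The tree is explored from a root, each new node being adjacent to a visited one, and the
  new vertices of its bag are appended to the ordering. The fill-in joins vertices that share a
  visited bag.\<close>

lemma tree_decomposition_elim_width:
  assumes G: "simple_graph G" and TB: "tree_decomposition G T B" "decomposition_width T B \<le> t"
  shows "elim_width t (verts G) (edge_rel G)"
proof -
  have T: "simple_graph T" "connected_graph T" "acyclic_graph T"
    using TB(1) by (auto simp: tree_decomposition_def is_tree_def)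
  have bags: "(\<Union>x\<in>verts T. B x) = verts G" "\<And>e. e \<in> edges G \<Longrightarrow> \<exists>x\<in>verts T. e \<subseteq> B x"
    "\<And>v. v \<in> verts G \<Longrightarrow> connected_graph (induce T {x \<in> verts T. v \<in> B x})"
    using TB(1) by (auto simp: tree_decomposition_def)
  have finT: "finite (verts T)" using T(1) by (simp add: simple_graph_def)
  have finB: "finite (B x)" if "x \<in> verts T" for x
    using that bags(1) G by (metis UN_upper finite_subset simple_graph_def)
  have cardB: "card (B x) \<le> Suc t" if "x \<in> verts T" for x
  proof -
    have "card (B x) \<le> Max ((\<lambda>x. card (B x)) ` verts T)" using finT that by (intro Max_ge) auto
    then show ?thesis using TB(2) unfolding decomposition_width_def by linarith
  qed
  define share where "share = (\<lambda>N p q. \<exists>x\<in>N. p \<in> B x \<and> q \<in> B x)"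
  let ?R = "\<lambda>N. {(a, b). a \<in> N \<and> b \<in> N \<and> (a, b) \<in> adj T}"
  have grow: "elim_width t (\<Union>x\<in>verts T. B x) (share (verts T))"
    if "N \<subseteq> verts T" "N \<noteq> {}" "\<forall>a\<in>N. \<forall>b\<in>N. (a, b) \<in> (?R N)\<^sup>*"
      "elim_width t (\<Union>x\<in>N. B x) (share N)" for N
    using that
  proof (induction "card (verts T - N)" arbitrary: N rule: less_induct)
    case less
    let ?U = "\<Union>x\<in>N. B x"
    show ?case
    proof (cases "N = verts T")
      case True
      then show ?thesis using less.prems by simp
    next
      case False
      then obtain r s where "r \<in> N" "s \<in> verts T" "s \<notin> N" using less.prems by blast
      moreover have "(r, s) \<in> (adj T)\<^sup>*"
        using T(2) calculation less.prems(1) by (auto simp: connected_graph_def)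
      ultimately obtain n l where nl: "(n, l) \<in> adj T" "n \<in> N" "l \<notin> N"
        by (metis rtrancl_crossing)
      have ln: "{l, n} \<in> edges T" using nl(1) by (simp add: adj_def insert_commute)
      then have l: "l \<in> verts T" using edge_verts[OF T(1)] by blast
      \<comment> \<open>Hence the old part of the new bag is already a clique: it lies in the bag of
        the neighbour \<open>n\<close>.\<close>
      have inter: "B l \<inter> ?U \<subseteq> B n"
      proof
        fix v assume "v \<in> B l \<inter> ?U"
        then obtain m where v: "v \<in> B l" "m \<in> N" "v \<in> B m" by blast
        show "v \<in> B n"
        proof (rule ccontr)
          assume "v \<notin> B n"
          \<comment> \<open>A walk from \<open>l\<close> to \<open>m\<close> through bags containing
            \<open>v\<close>, continued inside \<open>N\<close> to \<open>n\<close>, would bypass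
            the edge \<open>ln\<close>.\<close>
          let ?adj = "adj T - {(l, n), (n, l)}"
          let ?Tv = "{x \<in> verts T. v \<in> B x}"
          have "v \<in> verts G" using v l bags(1) by blast
          moreover have "l \<in> ?Tv" "m \<in> ?Tv" using v l less.prems(1) by auto
          ultimately have "(l, m) \<in> (adj (induce T ?Tv))\<^sup>*"
            using bags(3)[of v] by (auto simp: connected_graph_def induce_def)
          moreover have "adj (induce T ?Tv) \<subseteq> ?adj"
            using \<open>v \<notin> B n\<close> by (auto simp: adj_def induce_def)
          ultimately have "(l, m) \<in> ?adj\<^sup>*" using rtrancl_mono by blast
          moreover have "(m, n) \<in> (?R N)\<^sup>*" using less.prems(3) v nl by blast
          moreover have "?R N \<subseteq> ?adj" using nl by blast
          ultimately have "(l, n) \<in> ?adj\<^sup>*" by (meson rtrancl_mono rtrancl_trans subsetD)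
          then show False using acyclic_edge_is_bridge[OF T(1,3) ln] by blast
        qed
      qed
      have B_l: "(B l \<inter> ?U) \<union> (B l - ?U) = B l" by blast
      have ext: "elim_width t (?U \<union> (B l - ?U)) (\<lambda>p q. p \<in> ?U \<and> q \<in> ?U \<and> share N p q \<or>
          p \<in> (B l \<inter> ?U) \<union> (B l - ?U) \<and> q \<in> (B l \<inter> ?U) \<union> (B l - ?U))"
      proof (rule elim_width_add_clique[OF less.prems(4)])
        show "share N p q" if "p \<in> B l \<inter> ?U" "q \<in> B l \<inter> ?U" for p q
          using that inter nl(2) unfolding share_def by blast
        show "card ((B l \<inter> ?U) \<union> (B l - ?U)) \<le> Suc t" using cardB[OF l] B_l by simp
      qed (use finB[OF l] in auto)
      have UN: "(\<Union>x\<in>insert l N. B x) = ?U \<union> (B l - ?U)" by auto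
      show ?thesis
      proof (rule less.hyps)
        show "card (verts T - insert l N) < card (verts T - N)"
          using finT l nl(3) by (intro psubset_card_mono) auto
        show "elim_width t (\<Union>x\<in>insert l N. B x) (share (insert l N))"
          unfolding UN by (rule elim_width_mono[OF ext]) (auto simp: share_def)
        have "(l, n) \<in> ?R (insert l N)" "(n, l) \<in> ?R (insert l N)"
          using nl by (auto simp: adj_def insert_commute)
        moreover have "(a, b) \<in> (?R (insert l N))\<^sup>*" if "a \<in> N" "b \<in> N" for a b
        proof -
          have "?R N \<subseteq> ?R (insert l N)" by blast
          then show ?thesis using less.prems(3) that rtrancl_mono by blast
        qed
        ultimately show "\<forall>a\<in>insert l N. \<forall>b\<in>insert l N. (a, b) \<in> (?R (insert l N))\<^sup>*"
          using nl(2) by (metis (no_types, lifting) converse_rtrancl_into_rtrancl insertE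
              rtrancl.rtrancl_into_rtrancl rtrancl.rtrancl_refl)
      qed (use less.prems l in auto)
    qed
  qed
  obtain r where r: "r \<in> verts T" using T(2) by (auto simp: connected_graph_def)
  have "elim_width t ({} \<union> B r) (\<lambda>p q. p \<in> {} \<and> q \<in> {} \<and> True \<or> p \<in> {} \<union> B r \<and> q \<in> {} \<union> B r)"
    using finB[OF r] cardB[OF r] by (intro elim_width_add_clique elim_width.empty) auto
  then have "elim_width t (\<Union>x\<in>{r}. B x) (share {r})"
    by (simp add: share_def)
  then have "elim_width t (\<Union>x\<in>verts T. B x) (share (verts T))"
    using r by (intro grow[of "{r}"]) auto
  then show ?thesis
    unfolding bags(1)
  proof (rule elim_width_mono)
    fix p q assume "{p, q} \<in> edges G"
    then show "share (verts T) p q" using bags(2) unfolding share_def by blast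
  qed simp
qed

section \<open>Strong forests\<close>

abbreviation component :: "'a ugraph \<Rightarrow> 'a \<Rightarrow> 'a ugraph" where
  "component H v \<equiv> induce H {u. (v, u) \<in> (adj H)\<^sup>*}"

lemma finite_edges: "simple_graph G \<Longrightarrow> finite (edges G)"
  using edge_verts[of G] by (intro finite_subset[of "edges G" "Pow (verts G)"]) (auto simp: simple_graph_def)

text \<open>Every vertex of a cycle has two different neighbours on it, so the vertex set of a cycle
  violates \<open>forest\<close>.\<close>

lemma forest_acyclic:
  assumes "forest (edge_rel G) W"
  shows "acyclic_graph (induce G W)"
  unfolding acyclic_graph_def
proof
  assume "\<exists>p. is_cycle (induce G W) p"
  then obtain p where p: "3 \<le> length p" "distinct p" "set p \<subseteq> W"
    "\<And>i. i < length p \<Longrightarrow> {p ! i, p ! (Suc i mod length p)} \<in> edges G"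
    by (auto simp: is_cycle_def adj_def induce_def)
  have "set p \<noteq> {}" using p(1) by auto
  then obtain x where x: "x \<in> set p" and
    uniq: "\<And>q r. q \<in> set p \<Longrightarrow> r \<in> set p \<Longrightarrow> {x, q} \<in> edges G \<Longrightarrow> {x, r} \<in> edges G \<Longrightarrow> q = r"
    using assms p(3) unfolding forest_def by meson
  then obtain i where i: "i < length p" "x = p ! i" by (metis in_set_conv_nth)
  \<comment> \<open>The cyclic predecessor of \<open>i\<close>. Uniqueness makes it equal to the
    successor, which is impossible for length at least 3.\<close>
  define j where "j = (if i = 0 then length p - 1 else i - 1)"
  have "0 < length p" using p(1) by linarith
  have j: "j < length p" "Suc j mod length p = i" using i p(1) by (auto simp: j_def)
  have "p ! (Suc i mod length p) = p ! j"
    using uniq p(4)[OF i(1)] p(4)[OF j(1)] i(2) j \<open>0 < length p\<close> by (simp add: insert_commute)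
  then have "Suc i mod length p = j"
    using p(2) j(1) \<open>0 < length p\<close> by (simp add: nth_eq_iff_index_eq)
  then show False
    using i(1) p(1) by (cases "Suc i = length p") (auto simp: j_def split: if_splits)
qed

definition strong_part :: "nat \<Rightarrow> 'a ugraph \<Rightarrow> 'a set \<Rightarrow> 'a set" where
  "strong_part k G W = {v\<in>W. k \<le> card (edges (component (induce G W) v))}"

text \<open>Components with fewer than \<open>k\<close> edges are dropped as a whole. What remains
  is closed under reachability, so the other components do not change.\<close>

lemma strong_part_strong_forest:
  assumes G: "simple_graph G" and W: "W \<subseteq> verts G" "acyclic_graph (induce G W)"
  shows "strong_forest k G (induce G (strong_part k G W))"
    and "e \<in> edges G \<Longrightarrow> e \<subseteq> W \<Longrightarrow> u \<in> e \<Longrightarrow> k \<le> card (edges (component (induce G W) u)) \<Longrightarrow>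
      e \<in> edges (induce G (strong_part k G W))"
proof -
  define W' where "W' = strong_part k G W"
  let ?H = "induce G W" and ?H' = "induce G W'"
  have symH: "(b, a) \<in> (adj ?H)\<^sup>*" if "(a, b) \<in> (adj ?H)\<^sup>*" for a b
  proof -
    have "sym (adj ?H)" by (auto simp: sym_def adj_def insert_commute)
    then show ?thesis using that by (metis sym_rtrancl symD)
  qed
  have same: "component ?H a = component ?H b" if "(a, b) \<in> (adj ?H)\<^sup>*" for a b
    using that symH rtrancl_trans by (metis (no_types, lifting))
  have reachW: "b \<in> W" if "(a, b) \<in> (adj ?H)\<^sup>*" "a \<in> W" for a b
    using that by (induction rule: rtrancl_induct) (auto simp: adj_def induce_def)
  have closed: "b \<in> W'" if "(a, b) \<in> (adj ?H)\<^sup>*" "a \<in> W'" for a b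
    using that same[OF that(1)] reachW[OF that(1)] unfolding W'_def strong_part_def by simp
  have reach: "(a, b) \<in> (adj ?H')\<^sup>* \<longleftrightarrow> (a, b) \<in> (adj ?H)\<^sup>*" if "a \<in> W'" for a b
  proof
    have "adj ?H' \<subseteq> adj ?H" by (auto simp: adj_def induce_def W'_def strong_part_def)
    then show "(a, b) \<in> (adj ?H')\<^sup>* \<Longrightarrow> (a, b) \<in> (adj ?H)\<^sup>*" using rtrancl_mono by blast
    show "(a, b) \<in> (adj ?H')\<^sup>*" if "(a, b) \<in> (adj ?H)\<^sup>*"
      using that
    proof (induction rule: rtrancl_induct)
      case base
      show ?case by simp
    next
      case (step b d)
      have "(a, d) \<in> (adj ?H)\<^sup>*" using step.hyps by (rule rtrancl_into_rtrancl)
      then have "b \<in> W'" "d \<in> W'" using closed step.hyps(1) \<open>a \<in> W'\<close> by blast+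
      then have "(b, d) \<in> adj ?H'" using step.hyps(2) by (auto simp: adj_def induce_def)
      then show ?case using step.IH by (rule rtrancl_into_rtrancl[rotated])
    qed
  qed
  have comp: "edges (component ?H' v) = edges (component ?H v)" if "v \<in> W'" for v
  proof -
    have "{u. (v, u) \<in> (adj ?H)\<^sup>*} \<subseteq> W'" using closed that by blast
    moreover have "W' \<subseteq> W" by (auto simp: W'_def strong_part_def)
    moreover have "{u. (v, u) \<in> (adj ?H')\<^sup>*} = {u. (v, u) \<in> (adj ?H)\<^sup>*}" using reach[OF that] by simp
    ultimately show ?thesis unfolding induce_def by auto
  qed
  have "acyclic_graph ?H'"
    using W(2) unfolding acyclic_graph_def is_cycle_def adj_def induce_def W'_def strong_part_def by auto
  moreover have "k \<le> card (edges C)" if C: "C \<in> components ?H'" for C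
  proof -
    obtain v where v: "C = component ?H' v" "v \<in> verts ?H'"
      using C unfolding components_def by (rule imageE)
    then have "v \<in> W'" by (simp add: induce_def)
    then have "k \<le> card (edges (component ?H v))" by (simp add: W'_def strong_part_def)
    then show ?thesis using comp[OF \<open>v \<in> W'\<close>] v(1) by metis
  qed
  moreover have "W' \<subseteq> verts G" using W(1) by (auto simp: W'_def strong_part_def)
  then have "induced_subgraph ?H' G"
    unfolding induced_subgraph_def by (intro exI[of _ W']) simp
  ultimately show "strong_forest k G (induce G (strong_part k G W))"
    by (simp add: strong_forest_def W'_def)
  assume e: "e \<in> edges G" "e \<subseteq> W" "u \<in> e" "k \<le> card (edges (component ?H u))"
  then have "u \<in> W'" unfolding W'_def strong_part_def by blast
  have "v \<in> W'" if "v \<in> e" for v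
  proof (cases "v = u")
    case False
    then have "e = {u, v}" using e(1,3) that G by (auto simp: simple_graph_def)
    then have "(u, v) \<in> adj ?H" using e by (auto simp: adj_def induce_def)
    then show ?thesis using closed \<open>u \<in> W'\<close> by blast
  qed (use \<open>u \<in> W'\<close> in simp)
  then show "e \<in> edges (induce G (strong_part k G W))"
    using e by (auto simp: induce_def W'_def)
qed

text \<open>The given forests may have small components: each is trimmed to its strong part, which
  keeps every edge lying in a large component.\<close>

lemma strong_induced_arboricity_le:
  assumes G: "simple_graph G" and I: "finite I"
    and W: "\<And>i. i \<in> I \<Longrightarrow> W i \<subseteq> verts G" "\<And>i. i \<in> I \<Longrightarrow> forest (edge_rel G) (W i)"
    and cover: "\<And>e. valid_edge k G e \<Longrightarrow>
      \<exists>i\<in>I. \<exists>u\<in>e. e \<subseteq> W i \<and> k \<le> card (edges (component (induce G (W i)) u))"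
  shows "strong_induced_arboricity k G \<le> card I"
proof -
  define F where "F = (\<lambda>i. induce G (strong_part k G (W i)))"
  note strong = strong_part_strong_forest[OF G W(1) forest_acyclic[OF W(2)]]
  have "covers_valid_edges k G (F ` I)"
    unfolding covers_valid_edges_def
  proof (intro conjI ballI allI impI)
    show "strong_forest k G H" if "H \<in> F ` I" for H
      using that strong(1) unfolding F_def by blast
    fix e assume e: "valid_edge k G e"
    then obtain i u where "i \<in> I" "u \<in> e" "e \<subseteq> W i"
      "k \<le> card (edges (component (induce G (W i)) u))" using cover by blast
    moreover have "e \<in> edges G" using e by (simp add: valid_edge_def)
    ultimately have "e \<in> edges (F i)" unfolding F_def using strong(2) by blast
    then show "\<exists>H\<in>F ` I. e \<in> edges H" using \<open>i \<in> I\<close> by blast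
  qed (use I in simp)
  then have "strong_induced_arboricity k G \<le> card (F ` I)"
    unfolding strong_induced_arboricity_def by (intro Least_le) blast
  then show ?thesis using card_image_le[OF I] le_trans by blast
qed

lemma card_component_ge:
  assumes G: "simple_graph G" and E: "E \<subseteq> edges G" "\<And>e. e \<in> E \<Longrightarrow> e \<subseteq> W" "\<And>e. e \<in> E \<Longrightarrow> e \<inter> {u, v} \<noteq> {}"
    and uv: "{u, v} \<in> edges G" "u \<in> W" "v \<in> W"
  shows "card E \<le> card (edges (component (induce G W) u))"
proof (rule card_mono)
  show "finite (edges (component (induce G W) u))"
    using finite_edges[OF G] by (simp add: induce_def)
  show "E \<subseteq> edges (component (induce G W) u)"
  proof
    fix e assume e: "e \<in> E"
    have uv_adj: "(u, v) \<in> adj (induce G W)" using uv by (simp add: adj_def induce_def)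
    obtain a where a: "a \<in> e" "a \<in> {u, v}" using E(3)[OF e] by blast
    have ua: "(u, a) \<in> (adj (induce G W))\<^sup>*" using a uv_adj by auto
    have "(u, b) \<in> (adj (induce G W))\<^sup>*" if "b \<in> e" for b
    proof (cases "b = a")
      case False
      then have "e = {a, b}" using that a e E(1) G by (auto simp: simple_graph_def subset_iff)
      then have "(a, b) \<in> adj (induce G W)" using e E by (auto simp: adj_def induce_def)
      then show ?thesis using ua by (rule rtrancl_into_rtrancl[rotated])
    qed (use ua in simp)
    then show "e \<in> edges (component (induce G W) u)" using e E by (auto simp: induce_def)
  qed
qed

text \<open>The component of \<open>uv\<close> in a 2-strong forest has a second edge, so some edge
  leads from \<open>u\<close> or \<open>v\<close> to a third vertex \<open>w\<close>. Were
  \<open>w\<close> adjacent to both, the forest would contain a triangle.\<close>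

lemma valid_edge_2_distinguished:
  assumes G: "simple_graph G" and valid: "valid_edge 2 G {u, v}"
  shows "distinguished (verts G) (edge_rel G) u v"
proof -
  obtain W where W: "W \<subseteq> verts G" "strong_forest 2 G (induce G W)" "{u, v} \<in> edges (induce G W)"
    using valid unfolding valid_edge_def strong_forest_def induced_subgraph_def by blast
  let ?F = "induce G W"
  have uvW: "u \<in> W" "v \<in> W" "{u, v} \<in> edges G" using W(3) by (auto simp: induce_def)
  have irr: "{p, p} \<notin> edges G" for p using irreflp_edge_rel[OF G] by (auto dest: irreflpD)
  have "u \<noteq> v" using uvW irr by auto
  have "2 \<le> card (edges (component ?F u))"
    using W(2) uvW by (auto simp: strong_forest_def components_def induce_def)
  moreover have "card (edges (component ?F u)) \<le> 1" if "edges (component ?F u) \<subseteq> {{u, v}}"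
    using card_mono[OF _ that] by simp
  ultimately obtain e where e: "e \<in> edges (component ?F u)" "e \<noteq> {u, v}" by fastforce
  have "e \<in> edges G" "\<And>b. b \<in> e \<Longrightarrow> (u, b) \<in> (adj ?F)\<^sup>*" using e by (auto simp: induce_def)
  moreover obtain b where "b \<in> e" "b \<notin> {u, v}"
  proof -
    obtain p q where "e = {p, q}" "p \<noteq> q"
      using \<open>e \<in> edges G\<close> G unfolding simple_graph_def by blast
    then have "\<not> e \<subseteq> {u, v}" using e(2) by auto
    then show ?thesis using that by blast
  qed
  ultimately have "(u, b) \<in> (adj ?F)\<^sup>*" "u \<in> {u, v}" "b \<notin> {u, v}" by blast+
  then obtain a w where aw: "(a, w) \<in> adj ?F" "a \<in> {u, v}" "w \<notin> {u, v}"
    by (rule rtrancl_crossing)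
  have "w \<in> W" using aw by (auto simp: adj_def induce_def)
  have "\<not> ({u, w} \<in> edges G \<and> {v, w} \<in> edges G)"
  proof
    assume uvw: "{u, w} \<in> edges G \<and> {v, w} \<in> edges G"
    have "is_cycle ?F [u, v, w]"
      using uvw uvW \<open>w \<in> W\<close> \<open>u \<noteq> v\<close> aw(3)
      by (auto simp: is_cycle_def adj_def induce_def less_Suc_eq insert_commute)
    then show False using W(2) by (auto simp: strong_forest_def acyclic_graph_def)
  qed
  moreover have "{u, w} \<in> edges G \<or> {v, w} \<in> edges G"
    using aw by (auto simp: adj_def induce_def)
  ultimately show ?thesis
    using aw(3) \<open>w \<in> W\<close> W(1) unfolding distinguished_def by blast
qed

section \<open>The bounds on the strong induced arboricities\<close>

theorem theorem5:
  fixes G :: "'a ugraph" and t :: nat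
  assumes "simple_graph G"
    and "tree_width G = t"
    and "t \<ge> 2"
  shows "strong_induced_arboricity 1 G \<le> (t + 1) choose 2 \<and>
         strong_induced_arboricity 2 G \<le> 3 * ((t + 1) choose 3)"
proof
  let ?A = "edge_rel G" and ?V = "verts G"
  note G = assms(1)
  have A: "symp ?A" "irreflp ?A" using symp_edge_rel irreflp_edge_rel[OF G] by blast+
  have finV: "finite ?V" using G by (simp add: simple_graph_def)
  have "elim_width t ?V ?A"
    using tree_width_attained[OF G] tree_decomposition_elim_width[OF G] assms(2) by (metis order_refl)
  then obtain c :: "'a \<Rightarrow> nat" where c: "\<And>v. v \<in> ?V \<Longrightarrow> c v \<le> t"
    "\<And>p q. p \<in> ?V \<Longrightarrow> q \<in> ?V \<Longrightarrow> p \<noteq> q \<Longrightarrow> ?A p q \<Longrightarrow> c p \<noteq> c q"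
    "\<And>I m. finite I \<Longrightarrow> card I = Suc m \<Longrightarrow> elim_width m {v\<in>?V. c v \<in> I} ?A"
    by (rule elim_width_colouring) (use that in blast)
  have edgeE: "\<exists>u v. e = {u, v} \<and> u \<in> ?V \<and> v \<in> ?V \<and> u \<noteq> v \<and> e \<in> edges G" if "valid_edge k G e" for k e
    using that G unfolding valid_edge_def simple_graph_def by blast
  let ?I = "\<lambda>m. {P. P \<subseteq> {..t} \<and> card P = m}"
  have finI: "finite (?I m)" and cardI: "card (?I m) = (t + 1) choose m" for m
    using n_subsets[of "{..t}" m] by auto
  have finP: "finite P" if "P \<in> ?I m" for P m using that finite_subset by blast

  have "strong_induced_arboricity 1 G \<le> card (?I 2)"
  proof (rule strong_induced_arboricity_le[OF G finI, of _ "\<lambda>P. {v\<in>?V. c v \<in> P}"])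
    fix P assume P: "P \<in> ?I 2"
    then have "elim_width 1 {v\<in>?V. c v \<in> P} ?A" using finP[OF P] by (intro c(3)) auto
    then show "forest ?A {v\<in>?V. c v \<in> P}" using A by (rule elim_width_1_forest)
  next
    fix e assume "valid_edge 1 G e"
    then obtain u v where e: "e = {u, v}" "u \<in> ?V" "v \<in> ?V" "u \<noteq> v" "e \<in> edges G" using edgeE by blast
    let ?P = "{c u, c v}"
    have "c u \<noteq> c v" using c(2)[of u v] e by blast
    then have "?P \<in> ?I 2" using c(1) e by auto
    moreover have "card {e} \<le> card (edges (component (induce G {v\<in>?V. c v \<in> ?P}) u))"
      using e by (intro card_component_ge[OF G, of _ _ _ v]) auto
    ultimately show "\<exists>P\<in>?I 2. \<exists>u\<in>e. e \<subseteq> {v\<in>?V. c v \<in> P} \<and>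
        1 \<le> card (edges (component (induce G {v\<in>?V. c v \<in> P}) u))"
      using e by (intro bexI[of _ ?P] bexI[of _ u]) auto
  qed auto
  then show "strong_induced_arboricity 1 G \<le> (t + 1) choose 2" using cardI by simp

  let ?W = "\<lambda>P. {v\<in>?V. c v \<in> P}"
  have ex: "\<exists>d. good_colouring (?W P) ?A d" if P: "P \<in> ?I 3" for P
  proof (rule good_colouring_exists)
    show "elim_width 2 (?W P) ?A" using finP[OF P] P by (intro c(3)) auto
  qed (use finV A in auto)
  define d where "d P = (SOME d. good_colouring (?W P) ?A d)" for P
  have d: "good_colouring (?W P) ?A (d P)" if "P \<in> ?I 3" for P
    unfolding d_def using ex[OF that] by (rule someI_ex)
  \<comment> \<open>One forest for each set \<open>P\<close> of three colours and each class
    \<open>m\<close> deleted from the good colouring \<open>d P\<close>.\<close>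
  have "strong_induced_arboricity 2 G \<le> card (?I 3 \<times> {..<3::nat})"
  proof (rule strong_induced_arboricity_le[OF G, of _ "\<lambda>(P, m). {v\<in>?W P. d P v \<noteq> m}"])
    fix i assume "i \<in> ?I 3 \<times> {..<3::nat}"
    then obtain P m where i: "i = (P, m)" "P \<in> ?I 3" "m < 3" by blast
    show "forest ?A (case i of (P, m) \<Rightarrow> {v\<in>?W P. d P v \<noteq> m})"
      using good_colouringD(2)[OF d[OF i(2)] i(3)] i(1) by simp
  next
    fix e assume valid: "valid_edge 2 G e"
    then obtain u v where e: "e = {u, v}" "u \<in> ?V" "v \<in> ?V" "u \<noteq> v" "e \<in> edges G" using edgeE by blast
    then obtain w where w: "w \<in> ?V" "w \<noteq> u" "w \<noteq> v" "?A u w \<noteq> ?A v w"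
      using valid_edge_2_distinguished[OF G, of u v] valid by (auto simp: distinguished_def)
    have "{c u, c v, c w} \<subseteq> {..t}" using c(1) e w by auto
    moreover have "card {c u, c v, c w} \<le> 3" by (simp add: card_insert_if)
    moreover have "3 \<le> card {..t}" using assms(3) by simp
    \<comment> \<open>\<open>w\<close> may repeat a colour of \<open>u\<close> or \<open>v\<close>,
      so the set is filled up to three colours; \<open>t \<ge> 2\<close> ensures that there are
      enough.\<close>
    ultimately obtain P where P: "{c u, c v, c w} \<subseteq> P" "P \<in> ?I 3"
      using exists_subset_between[of "{c u, c v, c w}" 3 "{..t}"] by auto
    have mem: "u \<in> ?W P" "v \<in> ?W P" "w \<in> ?W P" using P(1) e w by auto
    have "distinguished (?W P) ?A u v" using w mem unfolding distinguished_def by blast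
    then have "accompanied (?W P) ?A (d P) u v"
      using good_colouringD(3)[OF d[OF P(2)] mem(1,2)] e by blast
    then obtain x where x: "x \<in> ?W P" "x \<noteq> u" "x \<noteq> v" "?A u x \<or> ?A v x"
      "d P u = d P v \<or> d P x = d P u \<or> d P x = d P v" by (rule accompaniedE)
    \<comment> \<open>At most two colours occur on \<open>u\<close>, \<open>v\<close>,
      \<open>x\<close>, so both edges survive the deletion of a third colour
      \<open>m\<close>.\<close>
    have "card {d P u, d P v, d P x} < card {..<3::nat}" using x(5) by (auto simp: card_insert_if)
    then have "\<not> {..<3} \<subseteq> {d P u, d P v, d P x}" by (meson card_mono finite.intros leD)
    then obtain m where m: "m < 3" "m \<notin> {d P u, d P v, d P x}" by blast
    let ?X = "{v\<in>?W P. d P v \<noteq> m}"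
    obtain f where f: "f \<in> edges G" "f \<subseteq> {u, v, x}" "x \<in> f" "f \<inter> {u, v} \<noteq> {}" using x(4) by blast
    have "f \<noteq> e" using f(3) x e(1) by blast
    have "card {e, f} \<le> card (edges (component (induce G ?X) u))"
      using e f mem x m by (intro card_component_ge[OF G, of _ _ _ v]) auto
    then have "2 \<le> card (edges (component (induce G ?X) u))" using \<open>f \<noteq> e\<close> by simp
    moreover have "e \<subseteq> ?X" using e mem m by auto
    ultimately show "\<exists>i\<in>?I 3 \<times> {..<3::nat}. \<exists>u\<in>e. e \<subseteq> (case i of (P, m) \<Rightarrow> {v\<in>?W P. d P v \<noteq> m}) \<and>
        2 \<le> card (edges (component (induce G (case i of (P, m) \<Rightarrow> {v\<in>?W P. d P v \<noteq> m})) u))"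
      using P(2) m(1) e(1) by (intro bexI[of _ "(P, m)"] bexI[of _ u]) auto
  qed (use finI in auto)
  then show "strong_induced_arboricity 2 G \<le> 3 * ((t + 1) choose 3)"
    using cardI by (simp add: card_cartesian_product)
qed

end
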